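(* Let $\delta>0$, let $P_0,P_1$ be distributions with $A_\delta<\infty$, and put $A=A_\delta$ and $C_M=\min\left\{D_{KL}\left(P_0\,\middle\|\,\frac{P_0+P_1}{2}\right),D_{KL}\left(P_1\,\middle\|\,\frac{P_0+P_1}{2}\right)\right\}$, where $P_0\neq P_1$ so that $C_M>0$. Let $X=\{x_1,\dots,x_n\}$ be $n$ data points drawn from $P_0,P_1$ with true change time $k^*\in(1,n)$. Then: (1) The MLE $\hat k$ is $(\alpha,\beta)$-accurate for any $\beta>0$ and $$\alpha=\frac{67}{C_M^2}\log\frac{64}{3\beta}.$$ (2) For any privacy parameter $\epsilon>0$, $\mathrm{OfflinePCPD}(X,P_0,P_1,\epsilon,\delta,n)$ is $(\alpha,\beta)$-accurate for any $\beta>0$ and $$\alpha=\max\left\{\frac{262}{C_M^2}\log\frac{128}{3\beta},\ \frac{2A\log(16/\beta)}{C_M\,\epsilon}\right\}.$$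
   Context: $P_0,P_1$ are probability distributions on $\mathbb{R}$, and $P_0(x),P_1(x)$ denote their densities (or mass functions) with respect to a common reference measure; $\frac{P_0+P_1}{2}$ is their equal mixture. $\log$ is the natural logarithm, with the convention $\log\frac00=0$. $D_{KL}(P\|Q)=\mathbb{E}_{x\sim P}\left[\log\frac{P(x)}{Q(x)}\right]$. Data $X=\{x_1,\dots,x_n\}$ are drawn from $P_0,P_1$ with true change time $k^*$ if $x_1,\dots,x_n$ are independent, $x_1,\dots,x_{k^*-1}$ are distributed as $P_0$, and $x_{k^*},\dots,x_n$ are distributed as $P_1$; $k^*$ is an integer. For $k\in\{1,\dots,n\}$, set $\ell(k)=\sum_{i=k}^n\log\frac{P_1(x_i)}{P_0(x_i)}$. The maximum likelihood estimator (MLE) is $\hat k=\mathrm{argmax}_{k\in\{1,\dots,n\}}\ell(k)$. For $\delta>0$, $$A_\delta=\min\left\{t:\ \max_{i=0,1}\Pr_{x\sim P_i}\left[2\left|\log\frac{P_1(x)}{P_0(x)}\right|>t\right]<\delta/2\right\}$$ (min is read as infimum if not attained; $A_\delta<\infty$ means that the set is nonempty). A (possibly randomized) change-point estimator $\tilde k(X)$ is $(\alpha,\beta)$-accurate if $\Pr[|\tilde k-k^*|<\alpha]\ge 1-\beta$, the probability being over the randomness of the algorithm and the sampling of $X$. $\mathrm{Lap}(b)$ is the Laplace distribution with density $\frac1{2b}e^{-|x|/b}$ (for $b=0$, the point mass at $0$). Algorithm $\mathrm{OfflinePCPD}(X,P_0,P_1,\epsilon,\delta,n)$ for $\delta>0$: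 let $A=A_\delta$; draw $Z_1,\dots,Z_n$ i.i.d. from $\mathrm{Lap}(A/\epsilon)$, independent of $X$; output $\tilde k=\mathrm{argmax}_{1\le k\le n}\{\ell(k)+Z_k\}$.
   Formalization: If some log-ratios are infinite, ℓ(k) may be +∞ for many k or undefined, and the claim fails; so candidates are compared by ℓ(j)−ℓ(k) with common terms cancelled (the same argmax when all ratios are finite). In A_δ only t≥0 is allowed, which matters only for δ>2. *)

theory Defs
  imports "HOL-Probability.Probability"
begin

section \<open>Log-likelihood ratios\<close>

text \<open>
  The densities \<open>p0\<close>, \<open>p1\<close> are real-valued functions with respect to a reference measure.
  Their log-likelihood ratio is extended-real: it is \<open>\<infinity>\<close> or \<open>-\<infinity>\<close> where exactly one of them
  vanishes. The library conventions \<open>ln 0 = 0\<close> and \<open>x / 0 = 0\<close> would make it \<open>0\<close> there.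
\<close>

definition llr :: "(real \<Rightarrow> real) \<Rightarrow> (real \<Rightarrow> real) \<Rightarrow> real \<Rightarrow> ereal" where
  "llr p0 p1 x =
     (if p0 x = 0 \<and> p1 x = 0 then 0
      else if p0 x = 0 then \<infinity>
      else if p1 x = 0 then - \<infinity>
      else ereal (ln (p1 x / p0 x)))"

definition mixture :: "real measure \<Rightarrow> (real \<Rightarrow> real) \<Rightarrow> (real \<Rightarrow> real) \<Rightarrow> real measure" where
  "mixture \<mu> p0 p1 = density \<mu> (\<lambda>x. ennreal ((p0 x + p1 x) / 2))"

text \<open>
  In the library, \<open>KL_divergence b M N\<close> integrates over \<open>N\<close> the logarithm of the density of
  \<open>N\<close> with respect to \<open>M\<close>, i.e. it is the divergence usually written \<open>D(N || M)\<close>.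
\<close>

definition C_M :: "real measure \<Rightarrow> (real \<Rightarrow> real) \<Rightarrow> (real \<Rightarrow> real) \<Rightarrow> real" where
  "C_M \<mu> p0 p1 =
     min (KL_divergence (exp 1) (mixture \<mu> p0 p1) (density \<mu> p0))
         (KL_divergence (exp 1) (mixture \<mu> p0 p1) (density \<mu> p1))"

text \<open>
  The threshold below is an infimum in the extended reals, so that it is \<open>\<infinity>\<close> when no finite
  threshold exists. The restriction \<open>0 \<le> t\<close> matters only for \<open>\<delta> > 2\<close>: for \<open>\<delta> \<le> 2\<close> a negative \<open>t\<close>
  never satisfies the condition.
\<close>

definition A_thr :: "real measure \<Rightarrow> (real \<Rightarrow> real) \<Rightarrow> (real \<Rightarrow> real) \<Rightarrow> real \<Rightarrow> ereal" where
  "A_thr \<mu> p0 p1 \<delta> =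
     (INF t\<in>{t::real. 0 \<le> t \<and>
         max (measure (density \<mu> p0) {x. 2 * \<bar>llr p0 p1 x\<bar> > ereal t})
             (measure (density \<mu> p1) {x. 2 * \<bar>llr p0 p1 x\<bar> > ereal t}) < \<delta> / 2}. ereal t)"

section \<open>Maximising the (noisy) log-likelihood\<close>

definition loglik :: "(real \<Rightarrow> real) \<Rightarrow> (real \<Rightarrow> real) \<Rightarrow> nat \<Rightarrow> (nat \<Rightarrow> real) \<Rightarrow> nat \<Rightarrow> ereal" where
  "loglik p0 p1 n x k = (\<Sum>i=k..n. llr p0 p1 (x i))"

text \<open>
  \<open>loglik_diff p0 p1 x j k\<close> is \<open>loglik p0 p1 n x j - loglik p0 p1 n x k\<close> with the common summands
  cancelled. Candidates are compared through it: if infinite log-likelihood ratios occur, the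
  plain sum may be \<open>\<infinity>\<close> for many candidates at once (or of the form \<open>\<infinity> - \<infinity>\<close>), although
  their likelihoods differ.
  The lemmas \<open>noisy_argmax_eq_loglik\<close> and \<open>noisy_argmax_eq_lik\<close> show that this yields the argmax of
  \<open>\<lambda>k. loglik p0 p1 n x k + z k\<close> whenever all the densities involved are positive, and in general the
  argmax of the likelihood, weighted with \<open>exp (z k)\<close>, whenever some likelihood is positive.
\<close>

definition loglik_diff :: "(real \<Rightarrow> real) \<Rightarrow> (real \<Rightarrow> real) \<Rightarrow> (nat \<Rightarrow> real) \<Rightarrow> nat \<Rightarrow> nat \<Rightarrow> ereal" where
  "loglik_diff p0 p1 x j k =
     (if j \<le> k then (\<Sum>i=j..<k. llr p0 p1 (x i)) else - (\<Sum>i=k..<j. llr p0 p1 (x i)))"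

definition noisy_argmax ::
  "(real \<Rightarrow> real) \<Rightarrow> (real \<Rightarrow> real) \<Rightarrow> nat \<Rightarrow> (nat \<Rightarrow> real) \<Rightarrow> (nat \<Rightarrow> real) \<Rightarrow> nat set" where
  "noisy_argmax p0 p1 n x z =
     {k\<in>{1..n}. \<forall>j\<in>{1..n}. loglik_diff p0 p1 x j k + ereal (z j) \<le> ereal (z k)}"

definition lik :: "(real \<Rightarrow> real) \<Rightarrow> (real \<Rightarrow> real) \<Rightarrow> nat \<Rightarrow> (nat \<Rightarrow> real) \<Rightarrow> nat \<Rightarrow> real" where
  "lik p0 p1 n x k = (\<Prod>i=1..<k. p0 (x i)) * (\<Prod>i=k..n. p1 (x i))"

lemma sum_llr_eq_ereal:
  assumes "finite I" "\<And>i. i \<in> I \<Longrightarrow> 0 < p0 (x i) \<and> 0 < p1 (x i)"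
  shows "(\<Sum>i\<in>I. llr p0 p1 (x i)) = ereal (\<Sum>i\<in>I. ln (p1 (x i) / p0 (x i)))"
proof -
  have "(\<Sum>i\<in>I. llr p0 p1 (x i)) = (\<Sum>i\<in>I. ereal (ln (p1 (x i) / p0 (x i))))"
    by (rule sum.cong) (use assms in \<open>force simp: llr_def\<close>)+
  then show ?thesis by simp
qed

lemma noisy_argmax_eq_loglik:
  assumes "\<And>i. i \<in> {1..n} \<Longrightarrow> 0 < p0 (x i) \<and> 0 < p1 (x i)"
  shows "noisy_argmax p0 p1 n x z =
    {k\<in>{1..n}. \<forall>j\<in>{1..n}. loglik p0 p1 n x j + ereal (z j) \<le> loglik p0 p1 n x k + ereal (z k)}"
proof -
  define r where "r i = ln (p1 (x i) / p0 (x i))" for i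
  have L: "loglik p0 p1 n x k = ereal (sum r {k..n})" if "k \<in> {1..n}" for k
    unfolding loglik_def r_def using that assms by (intro sum_llr_eq_ereal) auto
  have D: "loglik_diff p0 p1 x j k = ereal (sum r {j..n} - sum r {k..n})"
    if "j \<in> {1..n}" "k \<in> {1..n}" for j k
  proof -
    have split: "sum r {a..n} = sum r {a..<b} + sum r {b..n}" if "a \<le> b" "b \<le> n" for a b
      using that by (subst sum.union_disjoint[symmetric]) (auto simp: ivl_disj_un)
    have s: "(\<Sum>i=a..<b. llr p0 p1 (x i)) = ereal (sum r {a..<b})"
      if "a \<in> {1..n}" "b \<in> {1..n}" for a b
      unfolding r_def using that assms by (intro sum_llr_eq_ereal) auto
    show ?thesis
    proof (cases "j \<le> k")
      case True
      then show ?thesis using that split[of j k] s[of j k] by (simp add: loglik_diff_def)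
    next
      case False
      then show ?thesis using that split[of k j] s[of k j] by (simp add: loglik_diff_def)
    qed
  qed
  show ?thesis
    unfolding noisy_argmax_def by (intro Collect_cong) (auto simp: L D; fastforce)
qed

lemma sum_llr_not_PInf:
  assumes "finite I" "\<And>i. i \<in> I \<Longrightarrow> 0 < p0 (x i)"
  shows "(\<Sum>i\<in>I. llr p0 p1 (x i)) \<noteq> \<infinity>"
proof -
  have "llr p0 p1 (x i) \<noteq> \<infinity>" if "i \<in> I" for i
    using assms(2)[OF that] by (simp add: llr_def)
  then show ?thesis by (auto simp: sum_Pinfty)
qed

lemma sum_llr_le_iff:
  assumes I: "finite I" and nonneg: "\<And>t. 0 \<le> p1 t" and p0: "\<And>i. i \<in> I \<Longrightarrow> 0 < p0 (x i)"
  shows "(\<Sum>i\<in>I. llr p0 p1 (x i)) + ereal c \<le> ereal d \<longleftrightarrow>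
         (\<Prod>i\<in>I. p1 (x i)) * exp c \<le> (\<Prod>i\<in>I. p0 (x i)) * exp d" (is ?eq)
    and "- (\<Sum>i\<in>I. llr p0 p1 (x i)) + ereal c \<le> ereal d \<Longrightarrow> i \<in> I \<Longrightarrow> 0 < p1 (x i)"
proof -
  have P0: "0 < (\<Prod>i\<in>I. p0 (x i))" using p0 by (intro prod_pos) auto
  show ?eq
  proof (cases "\<forall>i\<in>I. 0 < p1 (x i)")
    case True
    have P1: "0 < (\<Prod>i\<in>I. p1 (x i))" using True by (intro prod_pos) auto
    have "(\<Sum>i\<in>I. ln (p1 (x i) / p0 (x i))) = ln (\<Prod>i\<in>I. p1 (x i) / p0 (x i))"
      using True p0 I by (subst ln_prod) (auto intro!: divide_pos_pos simp: less_imp_neq[symmetric])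
    also have "\<dots> = ln (\<Prod>i\<in>I. p1 (x i)) - ln (\<Prod>i\<in>I. p0 (x i))"
      using P0 P1 by (simp add: prod_dividef ln_div)
    finally have "(\<Sum>i\<in>I. llr p0 p1 (x i)) + ereal c \<le> ereal d \<longleftrightarrow>
        ln (\<Prod>i\<in>I. p1 (x i)) + c \<le> ln (\<Prod>i\<in>I. p0 (x i)) + d"
      using True p0 I by (subst sum_llr_eq_ereal) auto
    also have "\<dots> \<longleftrightarrow> exp (ln (\<Prod>i\<in>I. p1 (x i)) + c) \<le> exp (ln (\<Prod>i\<in>I. p0 (x i)) + d)"
      by simp
    also have "\<dots> \<longleftrightarrow> (\<Prod>i\<in>I. p1 (x i)) * exp c \<le> (\<Prod>i\<in>I. p0 (x i)) * exp d"
      unfolding exp_add using P0 P1 by simp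
    finally show ?thesis .
  next
    case False
    then obtain i where i: "i \<in> I" "p1 (x i) = 0" using nonneg by (metis order_le_less)
    have "(\<Sum>i\<in>I. llr p0 p1 (x i)) \<noteq> \<infinity>"
      using I p0 by (rule sum_llr_not_PInf)
    moreover have "\<bar>\<Sum>i\<in>I. llr p0 p1 (x i)\<bar> = \<infinity>"
      using i p0[OF i(1)] I by (subst sum_Inf) (auto intro!: bexI[of _ i] simp: llr_def)
    ultimately have "(\<Sum>i\<in>I. llr p0 p1 (x i)) = - \<infinity>" by auto
    moreover have "(\<Prod>i\<in>I. p1 (x i)) = 0" using i I by auto
    ultimately show ?thesis using P0 by simp
  qed
  show "0 < p1 (x i)" if le: "- (\<Sum>i\<in>I. llr p0 p1 (x i)) + ereal c \<le> ereal d" and i: "i \<in> I"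
  proof (rule ccontr)
    assume "\<not> 0 < p1 (x i)"
    then have i0: "p1 (x i) = 0" using nonneg[of "x i"] by simp
    have "(\<Sum>i\<in>I. llr p0 p1 (x i)) \<noteq> \<infinity>"
      using I p0 by (rule sum_llr_not_PInf)
    moreover have "\<bar>\<Sum>i\<in>I. llr p0 p1 (x i)\<bar> = \<infinity>"
      using i i0 p0[OF i(1)] I by (subst sum_Inf) (auto intro!: bexI[of _ i] simp: llr_def)
    ultimately have "(\<Sum>i\<in>I. llr p0 p1 (x i)) = - \<infinity>" by auto
    then show False using le by simp
  qed
qed

lemma llr_swap:
  assumes "0 \<le> p0 t" "0 \<le> p1 t"
  shows "llr p1 p0 t = - llr p0 p1 t"
  using assms by (auto simp: llr_def ln_div order_le_less)

lemma sum_llr_swap: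
  assumes I: "finite I" and "\<And>t. 0 \<le> p0 t" "\<And>t. 0 \<le> p1 t"
    and p1: "\<And>i. i \<in> I \<Longrightarrow> 0 < p1 (x i)"
  shows "- (\<Sum>i\<in>I. llr p0 p1 (x i)) = (\<Sum>i\<in>I. llr p1 p0 (x i))"
proof -
  have "(\<Sum>i\<in>I. llr p0 p1 (x i)) = (\<Sum>i\<in>I. - llr p1 p0 (x i))"
    using assms by (intro sum.cong) (auto simp: llr_swap[of p0 _ p1])
  also have "\<dots> = - (\<Sum>i\<in>I. llr p1 p0 (x i))"
    using I p1
  proof (induction I rule: finite_induct)
    case (insert a F)
    have "llr p1 p0 (x a) \<noteq> \<infinity>" "(\<Sum>i\<in>F. llr p1 p0 (x i)) \<noteq> \<infinity>"
      using insert.hyps insert.prems sum_llr_not_PInf[of "{a}" p1 x p0]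
        sum_llr_not_PInf[of F p1 x p0] by auto
    then show ?case using insert by (cases "llr p1 p0 (x a)"; cases "\<Sum>i\<in>F. llr p1 p0 (x i)") auto
  qed auto
  finally show ?thesis by simp
qed

lemma noisy_argmax_eq_lik:
  assumes nonneg: "\<And>t. 0 \<le> p0 t" "\<And>t. 0 \<le> p1 t"
    and pos: "\<exists>k\<in>{1..n}. 0 < lik p0 p1 n x k"
  shows "noisy_argmax p0 p1 n x z =
    {k\<in>{1..n}. \<forall>j\<in>{1..n}. lik p0 p1 n x j * exp (z j) \<le> lik p0 p1 n x k * exp (z k)}"
    (is "?L = ?R")
proof -
  let ?l = "lik p0 p1 n x"
  let ?P = "\<lambda>k. (\<forall>i\<in>{1..<k}. 0 < p0 (x i)) \<and> (\<forall>i\<in>{k..n}. 0 < p1 (x i))"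
  have lik_pos: "0 < ?l k \<longleftrightarrow> ?P k" for k
  proof -
    have "0 < (\<Prod>i\<in>I. p (x i)) \<longleftrightarrow> (\<forall>i\<in>I. 0 < p (x i))"
      if "finite I" "\<And>t. 0 \<le> p t" for I :: "nat set" and p :: "real \<Rightarrow> real"
      using that by (metis prod_pos prod_nonneg prod_zero order_le_less less_irrefl)
    from this[of "{1..<k}" p0] this[of "{k..n}" p1] show ?thesis
      using nonneg prod_nonneg[of "{1..<k}" "\<lambda>i. p0 (x i)"] prod_nonneg[of "{k..n}" "\<lambda>i. p1 (x i)"]
      unfolding lik_def by (auto simp: zero_less_mult_iff)
  qed
  have cmp: "loglik_diff p0 p1 x j k + ereal (z j) \<le> ereal (z k) \<longleftrightarrow>
      ?l j * exp (z j) \<le> ?l k * exp (z k)"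
    if j: "j \<in> {1..n}" and k: "k \<in> {1..n}" and P: "?P k" for j k
  proof (cases "j \<le> k")
    case True
    define a where "a = (\<Prod>i=1..<j. p0 (x i)) * (\<Prod>i=k..n. p1 (x i))"
    have a: "0 < a"
      unfolding a_def using P True by (intro mult_pos_pos prod_pos) auto
    have "(\<Prod>i=1..<k. p0 (x i)) = (\<Prod>i=1..<j. p0 (x i)) * (\<Prod>i=j..<k. p0 (x i))"
      using True j by (subst prod.union_disjoint[symmetric]) (auto simp: ivl_disj_un)
    moreover have "(\<Prod>i=j..n. p1 (x i)) = (\<Prod>i=j..<k. p1 (x i)) * (\<Prod>i=k..n. p1 (x i))"
      using True k by (subst prod.union_disjoint[symmetric]) (auto simp: ivl_disj_un)
    ultimately have eq: "?l j = a * (\<Prod>i=j..<k. p1 (x i))" "?l k = a * (\<Prod>i=j..<k. p0 (x i))"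
      by (simp_all add: lik_def a_def)
    have "(\<Sum>i=j..<k. llr p0 p1 (x i)) + ereal (z j) \<le> ereal (z k) \<longleftrightarrow>
        (\<Prod>i=j..<k. p1 (x i)) * exp (z j) \<le> (\<Prod>i=j..<k. p0 (x i)) * exp (z k)"
      using P j nonneg by (intro sum_llr_le_iff(1)) auto
    then show ?thesis
      unfolding eq loglik_diff_def using True a by (simp add: mult.assoc)
  next
    case False
    define a where "a = (\<Prod>i=1..<k. p0 (x i)) * (\<Prod>i=j..n. p1 (x i))"
    have a: "0 < a"
      unfolding a_def using P False by (intro mult_pos_pos prod_pos) auto
    have "(\<Prod>i=1..<j. p0 (x i)) = (\<Prod>i=1..<k. p0 (x i)) * (\<Prod>i=k..<j. p0 (x i))"
      using False k by (subst prod.union_disjoint[symmetric]) (auto simp: ivl_disj_un)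
    moreover have "(\<Prod>i=k..n. p1 (x i)) = (\<Prod>i=k..<j. p1 (x i)) * (\<Prod>i=j..n. p1 (x i))"
      using False j by (subst prod.union_disjoint[symmetric]) (auto simp: ivl_disj_un)
    ultimately have eq: "?l j = a * (\<Prod>i=k..<j. p0 (x i))" "?l k = a * (\<Prod>i=k..<j. p1 (x i))"
      by (simp_all add: lik_def a_def)
    have "- (\<Sum>i=k..<j. llr p0 p1 (x i)) = (\<Sum>i=k..<j. llr p1 p0 (x i))"
      using P j nonneg by (intro sum_llr_swap) auto
    moreover have "(\<Sum>i=k..<j. llr p1 p0 (x i)) + ereal (z j) \<le> ereal (z k) \<longleftrightarrow>
        (\<Prod>i=k..<j. p0 (x i)) * exp (z j) \<le> (\<Prod>i=k..<j. p1 (x i)) * exp (z k)"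
      using P j nonneg by (intro sum_llr_le_iff(1)) auto
    ultimately show ?thesis
      unfolding eq loglik_diff_def using False a by (simp add: mult.assoc)
  qed
  obtain m where m: "m \<in> {1..n}" "?P m" using pos lik_pos by blast
  have "?P k" if kL: "k \<in> ?L" for k
  proof -
    have k: "k \<in> {1..n}" and le: "loglik_diff p0 p1 x m k + ereal (z m) \<le> ereal (z k)"
      using kL m by (auto simp: noisy_argmax_def)
    show ?thesis
    proof (cases "m \<le> k")
      case True
      have "- (\<Sum>i=m..<k. llr p0 p1 (x i)) = (\<Sum>i=m..<k. llr p1 p0 (x i))"
        using m k nonneg by (intro sum_llr_swap) auto
      then have "- (\<Sum>i=m..<k. llr p1 p0 (x i)) = (\<Sum>i=m..<k. llr p0 p1 (x i))"
        by (metis ereal_uminus_uminus)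
      then have "- (\<Sum>i=m..<k. llr p1 p0 (x i)) + ereal (z m) \<le> ereal (z k)"
        using le True by (simp add: loglik_diff_def)
      then have "0 < p0 (x i)" if "i \<in> {m..<k}" for i
        using sum_llr_le_iff(2)[of "{m..<k}" p0 p1 x] that m k nonneg by auto
      then show ?thesis using m True by (metis atLeastAtMost_iff atLeastLessThan_iff linorder_not_less order_trans)
    next
      case False
      then have "- (\<Sum>i=k..<m. llr p0 p1 (x i)) + ereal (z m) \<le> ereal (z k)"
        using le by (simp add: loglik_diff_def)
      then have "0 < p1 (x i)" if "i \<in> {k..<m}" for i
        using sum_llr_le_iff(2)[of "{k..<m}" p1 p0 x] that m k nonneg by auto
      then show ?thesis using m False by (metis atLeastAtMost_iff atLeastLessThan_iff linorder_not_less order_less_trans nat_less_le)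
    qed
  qed
  moreover have "?P k" if kR: "k \<in> ?R" for k
  proof -
    have "0 < ?l m * exp (z m)" using m lik_pos by simp
    also have "\<dots> \<le> ?l k * exp (z k)" using kR m by auto
    finally have "0 < ?l k" by (simp add: zero_less_mult_iff)
    then show ?thesis using lik_pos by blast
  qed
  ultimately show ?thesis
    unfolding noisy_argmax_def using cmp by (smt (verit) Collect_cong mem_Collect_eq)
qed

section \<open>Estimators\<close>

text \<open>
  Estimators are random variables on the probability space \<open>M\<close> that carries the data and all
  randomness of the algorithm. Ties in the argmax may be broken in any measurable way.
\<close>

definition accurate :: "'a measure \<Rightarrow> nat \<Rightarrow> real \<Rightarrow> real \<Rightarrow> ('a \<Rightarrow> nat) \<Rightarrow> bool" where
  "accurate M kstar \<alpha> \<beta> ktil \<longleftrightarrow>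
     measure M {\<omega>\<in>space M. \<bar>real (ktil \<omega>) - real kstar\<bar> < \<alpha>} \<ge> 1 - \<beta>"

definition change_point_data ::
  "'a measure \<Rightarrow> real measure \<Rightarrow> (real \<Rightarrow> real) \<Rightarrow> (real \<Rightarrow> real) \<Rightarrow> nat \<Rightarrow> nat \<Rightarrow> (nat \<Rightarrow> 'a \<Rightarrow> real) \<Rightarrow> bool"
where
  "change_point_data M \<mu> p0 p1 n kstar X \<longleftrightarrow>
     prob_space.indep_vars M (\<lambda>_. borel) X {1..n} \<and>
     (\<forall>i\<in>{1..<kstar}. distr M borel (X i) = density \<mu> p0) \<and>
     (\<forall>i\<in>{kstar..n}. distr M borel (X i) = density \<mu> p1)"

definition is_MLE ::
  "'a measure \<Rightarrow> (real \<Rightarrow> real) \<Rightarrow> (real \<Rightarrow> real) \<Rightarrow> nat \<Rightarrow> (nat \<Rightarrow> 'a \<Rightarrow> real) \<Rightarrow> ('a \<Rightarrow> nat) \<Rightarrow> bool"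
where
  "is_MLE M p0 p1 n X khat \<longleftrightarrow>
     khat \<in> M \<rightarrow>\<^sub>M count_space UNIV \<and>
     (AE \<omega> in M. khat \<omega> \<in> noisy_argmax p0 p1 n (\<lambda>i. X i \<omega>) (\<lambda>_. 0))"

definition Lap :: "real \<Rightarrow> real measure" where
  "Lap b = (if b = 0 then return borel 0
            else density lborel (\<lambda>x. ennreal (1 / (2 * b) * exp (- \<bar>x\<bar> / b))))"

definition is_OfflinePCPD ::
  "'a measure \<Rightarrow> real measure \<Rightarrow> (real \<Rightarrow> real) \<Rightarrow> (real \<Rightarrow> real) \<Rightarrow> real \<Rightarrow> real \<Rightarrow> nat \<Rightarrow>
   (nat \<Rightarrow> 'a \<Rightarrow> real) \<Rightarrow> ('a \<Rightarrow> nat) \<Rightarrow> bool"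
where
  "is_OfflinePCPD M \<mu> p0 p1 \<epsilon> \<delta> n X ktil \<longleftrightarrow>
     ktil \<in> M \<rightarrow>\<^sub>M count_space UNIV \<and>
     (\<exists>Z. prob_space.indep_vars M (\<lambda>_. borel) Z {1..n} \<and>
        (\<forall>k\<in>{1..n}. distr M borel (Z k) = Lap (real_of_ereal (A_thr \<mu> p0 p1 \<delta>) / \<epsilon>)) \<and>
        prob_space.indep_var M
          (PiM {1..n} (\<lambda>_. borel)) (\<lambda>\<omega>. \<lambda>i\<in>{1..n}. X i \<omega>)
          (PiM {1..n} (\<lambda>_. borel)) (\<lambda>\<omega>. \<lambda>i\<in>{1..n}. Z i \<omega>) \<and>
        (AE \<omega> in M. ktil \<omega> \<in> noisy_argmax p0 p1 n (\<lambda>i. X i \<omega>) (\<lambda>k. Z k \<omega>)))"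

end

theory Submission
  imports Defs
begin

text \<open>
  Let \<open>\<rho>\<close> be the integral of \<open>sqrt (p0 * p1)\<close> and \<open>h = 1 - \<rho>\<close>. Then \<open>C_M \<le> 3/2 * h\<close>. By Markov's
  inequality applied to the square root of the likelihood ratio, a candidate that lies \<open>m\<close> steps
  further out than another one on the same side of the true change point has likelihood at least
  \<open>exp (- \<tau>)\<close> times that of the other one with probability at most
  \<open>exp (\<tau> / 2) * \<rho> ^ m \<le> exp (\<tau> / 2 - h * m)\<close>. For the MLE, \<open>\<tau> = 0\<close> and a union bound suffice.

  For the noisy estimator a union bound over the noise would lose a factor of the order of the noise
  scale \<open>b = A / \<epsilon>\<close>, which is unbounded. Instead, a far candidate \<open>m\<close> is compared with a near
  candidate \<open>j\<close>. If the log-likelihood of \<open>m\<close> is smaller by \<open>\<Delta>\<close>, then, for fixed data, the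
  probability that \<open>m\<close> wins is at most \<open>4 * exp (- \<Delta> / (2 * b))\<close> times the probability that \<open>j\<close>
  strictly wins. With \<open>w = floor \<alpha>\<close>, a candidate at distance \<open>d\<close> is compared with the one at
  distance \<open>d mod w\<close>; the win probabilities of the near candidates add up to at most 1, which leaves
  a geometric series in \<open>d div w\<close>.
\<close>

section \<open>Divergence from the mixture and Hellinger affinity\<close>

text \<open>The relative densities lie in \<open>[0, 2]\<close>, so this crude bound makes the
  integrands of both divergences integrable. It comes from \<open>ln t \<le> t - 1\<close> at
  \<open>t = x\<close> and at \<open>t = 1 / x\<close>.\<close>

lemma abs_xlnx_le:
  assumes "0 \<le> x" "x \<le> (2::real)"
  shows "\<bar>x * ln x\<bar> \<le> 4"
proof (cases "x = 0")
  case False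
  then have x: "0 < x" using assms by simp
  have "x * ln x \<le> 2 * 2"
    using x assms ln_le_minus_one[OF x] mult_left_mono[of "ln x" 2 x] by linarith
  moreover have "x * - ln x \<le> x * (1 / x)"
    using x ln_le_minus_one[of "1 / x"] by (intro mult_left_mono) (auto simp: ln_div)
  ultimately show ?thesis using x by (auto simp: abs_le_iff)
qed auto

text \<open>
  With \<open>ln u = 2 * ln (sqrt u) \<le> 2 * (sqrt u - 1)\<close> the sum is at most
  \<open>2 * (u powr (3/2) + v powr (3/2) - 2)\<close>, and \<open>(sqrt u + sqrt v)\<^sup>2 = 2 + 2 * sqrt (u * v)\<close>.
\<close>
lemma xlnx_add_le:
  fixes u v :: real
  assumes u: "0 \<le> u" and v: "0 \<le> v" and uv: "u + v = 2"
  shows "u * ln u + v * ln v \<le> 3 * (1 - sqrt (u * v))"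
proof -
  define a b where "a = sqrt u" and "b = sqrt v"
  have ab: "0 \<le> a" "0 \<le> b" "u = a\<^sup>2" "v = b\<^sup>2" "a\<^sup>2 + b\<^sup>2 = 2"
    using assms by (auto simp: a_def b_def)
  have le: "x\<^sup>2 * ln (x\<^sup>2) \<le> 2 * x ^ 3 - 2 * x\<^sup>2" if "0 \<le> x" for x :: real
  proof (cases "x = 0")
    case False
    then have "x\<^sup>2 * ln (x\<^sup>2) = 2 * x\<^sup>2 * ln x"
      using that by (simp add: ln_realpow)
    also have "\<dots> \<le> 2 * x\<^sup>2 * (x - 1)"
      using False that ln_le_minus_one[of x] by (intro mult_left_mono) auto
    finally show ?thesis by (simp add: algebra_simps power2_eq_square power3_eq_cube)
  qed auto
  define s t where "s = a + b" and "t = a * b"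
  have s2: "s\<^sup>2 = 2 + 2 * t"
    using ab by (simp add: s_def t_def power2_sum)
  have t: "0 \<le> t" "t \<le> 1"
    using ab sum_squares_bound[of a b] by (auto simp: t_def)
  \<comment> \<open>A bound for \<open>s\<close> that is linear in \<open>t\<close>, from
    \<open>(s - 2)^2 \<ge> 0\<close>; it is tight at \<open>s = 2\<close>, \<open>t = 1\<close>,
    that is at \<open>u = v = 1\<close>.\<close>
  have "s \<le> (3 + t) / 2"
    using zero_le_power2[of "s - 2"] s2 by (simp add: power2_diff)
  have "a ^ 3 + b ^ 3 = s * (2 - t)"
  proof -
    have "a ^ 3 + b ^ 3 = (a + b) * (a\<^sup>2 + b\<^sup>2 - a * b)"
      by (simp add: algebra_simps power2_eq_square power3_eq_cube)
    then show ?thesis using ab by (simp add: s_def t_def)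
  qed
  also have "\<dots> \<le> (3 + t) / 2 * (2 - t)"
    using \<open>s \<le> (3 + t) / 2\<close> t by (intro mult_right_mono) auto
  also have "\<dots> = 2 + (1 - t) * (2 + t) / 2"
    by (simp add: field_simps)
  also have "\<dots> \<le> 2 + (1 - t) * 3 / 2"
    using t by (intro add_left_mono divide_right_mono mult_left_mono) auto
  finally have "2 * (a ^ 3 + b ^ 3) - 4 \<le> 3 * (1 - t)" by (simp add: field_simps)
  moreover have "sqrt (u * v) = t"
    by (simp add: t_def a_def b_def real_sqrt_mult)
  ultimately show ?thesis
    using le[OF ab(1)] le[OF ab(2)] ab by simp
qed

section \<open>Affinity, Hellinger distance and densities relative to the mixture\<close>

locale density_pair =
  fixes \<mu> :: "real measure" and p0 p1 :: "real \<Rightarrow> real"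
  assumes sets_mu [measurable_cong]: "sets \<mu> = sets borel"
    and meas [measurable]: "p0 \<in> borel_measurable borel" "p1 \<in> borel_measurable borel"
    and nonneg: "\<And>x. 0 \<le> p0 x" "\<And>x. 0 \<le> p1 x"
    and prob: "prob_space (density \<mu> p0)" "prob_space (density \<mu> p1)"
begin

text \<open>The Bhattacharyya coefficient of the two distributions.\<close>

definition affinity :: real where
  "affinity = (\<integral>x. sqrt (p0 x * p1 x) \<partial>\<mu>)"

text \<open>Half the integral of \<open>(sqrt p0 - sqrt p1)^2\<close>, i.e. the squared Hellinger
  distance normalised to \<open>[0, 1]\<close>.\<close>

definition hellinger :: real where
  "hellinger = 1 - affinity"

text \<open>For \<open>p = p0\<close> or \<open>p = p1\<close> this is the Radon-Nikodym derivative
  with respect to the mixture. Where \<open>p0 + p1\<close> vanishes, division by zero gives 0; this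
  is a null set of the mixture.\<close>

definition relden :: "(real \<Rightarrow> real) \<Rightarrow> real \<Rightarrow> real" where
  "relden p x = p x / ((p0 x + p1 x) / 2)"

lemma nn_integral_density_eq_1:
  "(\<integral>\<^sup>+x. ennreal (p0 x) \<partial>\<mu>) = 1" "(\<integral>\<^sup>+x. ennreal (p1 x) \<partial>\<mu>) = 1"
  using prob_space.emeasure_space_1[OF prob(1)] prob_space.emeasure_space_1[OF prob(2)]
  by (simp_all add: emeasure_density cong: nn_integral_cong)

lemma integrable_density: "integrable \<mu> p0" "integrable \<mu> p1"
  using nonneg nn_integral_density_eq_1 by (auto intro!: integrableI_nonneg)

lemma integral_density_eq_1: "integral\<^sup>L \<mu> p0 = 1" "integral\<^sup>L \<mu> p1 = 1"
  using nonneg nn_integral_density_eq_1 by (auto simp: integral_eq_nn_integral)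

lemma sqrt_mult_le: "sqrt (p0 x * p1 x) \<le> (p0 x + p1 x) / 2"
  using arith_geo_mean_sqrt[of "p0 x" "p1 x"] nonneg by simp

lemma integrable_affinity: "integrable \<mu> (\<lambda>x. sqrt (p0 x * p1 x))"
proof (rule Bochner_Integration.integrable_bound[where f = "\<lambda>x. (p0 x + p1 x) / 2"])
  show "integrable \<mu> (\<lambda>x. (p0 x + p1 x) / 2)"
    using integrable_density by auto
qed (use sqrt_mult_le nonneg in auto)

lemma nn_integral_affinity: "(\<integral>\<^sup>+x. ennreal (sqrt (p0 x * p1 x)) \<partial>\<mu>) = ennreal affinity"
  unfolding affinity_def using nonneg
  by (intro nn_integral_eq_integral integrable_affinity) auto

lemma affinity_nonneg: "0 \<le> affinity"
  unfolding affinity_def using nonneg by (intro Bochner_Integration.integral_nonneg) auto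

lemma affinity_le_1: "affinity \<le> 1"
proof -
  have "affinity \<le> (\<integral>x. (p0 x + p1 x) / 2 \<partial>\<mu>)"
    unfolding affinity_def using integrable_affinity integrable_density sqrt_mult_le
    by (intro integral_mono) auto
  also have "\<dots> = 1"
    using integrable_density integral_density_eq_1 by simp
  finally show ?thesis .
qed

lemma hellinger_bounds: "0 \<le> hellinger" "hellinger \<le> 1"
  using affinity_nonneg affinity_le_1 by (auto simp: hellinger_def)

lemma affinity_le_exp: "affinity \<le> exp (- hellinger)"
  using exp_ge_add_one_self[of "- hellinger"] by (simp add: hellinger_def)

lemma relden_meas [measurable]: "relden p0 \<in> borel_measurable borel" "relden p1 \<in> borel_measurable borel"
  unfolding relden_def by measurable

lemma sets_mixture [measurable_cong]: "sets (mixture \<mu> p0 p1) = sets borel"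
  by (simp add: mixture_def sets_mu)

lemma prob_space_mixture: "prob_space (mixture \<mu> p0 p1)"
proof
  have "(\<integral>\<^sup>+x. ennreal ((p0 x + p1 x) / 2) \<partial>\<mu>) = ennreal (\<integral>x. (p0 x + p1 x) / 2 \<partial>\<mu>)"
    using nonneg integrable_density by (intro nn_integral_eq_integral) auto
  also have "\<dots> = 1"
    using integrable_density integral_density_eq_1 by simp
  finally show "emeasure (mixture \<mu> p0 p1) (space (mixture \<mu> p0 p1)) = 1"
    unfolding mixture_def by (simp add: emeasure_density cong: nn_integral_cong)
qed

lemma AE_mixture_pos: "AE x in mixture \<mu> p0 p1. 0 < p0 x + p1 x"
  unfolding mixture_def by (subst AE_density) (auto simp: ennreal_less_zero_iff)

lemma relden_nonneg: "0 \<le> relden p0 x" "0 \<le> relden p1 x"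
  using nonneg by (auto simp: relden_def)

lemma relden_sum: "0 < p0 x + p1 x \<Longrightarrow> relden p0 x + relden p1 x = 2"
  by (simp add: relden_def divide_simps)

lemma relden_le_2: "relden p0 x \<le> 2" "relden p1 x \<le> 2"
  using nonneg[of x] by (auto simp: relden_def divide_simps)

text \<open>Makes the mixture the base measure, which is the form in which a divergence from it can
  be computed as an integral.\<close>

lemma density_mixture_relden:
  "density (mixture \<mu> p0 p1) (relden p0) = density \<mu> p0"
  "density (mixture \<mu> p0 p1) (relden p1) = density \<mu> p1"
proof -
  have *: "density (mixture \<mu> p0 p1) (relden p) = density \<mu> p"
    if [measurable]: "p \<in> borel_measurable borel"
      and p: "\<And>x. 0 \<le> p x" "\<And>x. p x \<le> p0 x + p1 x" for p
  proof -
    have "density (mixture \<mu> p0 p1) (relden p) =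
        density \<mu> (\<lambda>x. ennreal ((p0 x + p1 x) / 2) * ennreal (relden p x))"
      unfolding mixture_def relden_def by (subst density_density_eq) auto
    also have "\<dots> = density \<mu> p"
    proof (intro density_cong AE_I2)
      fix x
      \<comment> \<open>Where \<open>p0 + p1\<close> vanishes, the bound
        \<open>p \<le> p0 + p1\<close> forces \<open>p\<close> to vanish as well.\<close>
      have "(p0 x + p1 x) / 2 * relden p x = p x"
        using p[of x] nonneg[of x] by (cases "p0 x + p1 x = 0") (auto simp: relden_def)
      then show "ennreal ((p0 x + p1 x) / 2) * ennreal (relden p x) = ennreal (p x)"
        using nonneg[of x] by (subst ennreal_mult'[symmetric]) auto
    qed (auto simp: relden_def)
    finally show ?thesis .
  qed
  show "density (mixture \<mu> p0 p1) (relden p0) = density \<mu> p0"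
    "density (mixture \<mu> p0 p1) (relden p1) = density \<mu> p1"
    using nonneg by (auto intro!: *)
qed

lemma integrable_xlnx:
  "integrable (mixture \<mu> p0 p1) (\<lambda>x. relden p0 x * ln (relden p0 x))"
  "integrable (mixture \<mu> p0 p1) (\<lambda>x. relden p1 x * ln (relden p1 x))"
proof -
  interpret Q: prob_space "mixture \<mu> p0 p1" by (rule prob_space_mixture)
  show "integrable (mixture \<mu> p0 p1) (\<lambda>x. relden p0 x * ln (relden p0 x))"
    "integrable (mixture \<mu> p0 p1) (\<lambda>x. relden p1 x * ln (relden p1 x))"
    using abs_xlnx_le relden_nonneg relden_le_2
    by (auto intro!: Q.integrable_const_bound[where B = 4])
qed

lemma KL_mixture:
  "KL_divergence (exp 1) (mixture \<mu> p0 p1) (density \<mu> p0) =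
     (\<integral>x. relden p0 x * ln (relden p0 x) \<partial>mixture \<mu> p0 p1)"
  "KL_divergence (exp 1) (mixture \<mu> p0 p1) (density \<mu> p1) =
     (\<integral>x. relden p1 x * ln (relden p1 x) \<partial>mixture \<mu> p0 p1)"
proof -
  interpret Q: prob_space "mixture \<mu> p0 p1" by (rule prob_space_mixture)
  show "KL_divergence (exp 1) (mixture \<mu> p0 p1) (density \<mu> p0) =
     (\<integral>x. relden p0 x * ln (relden p0 x) \<partial>mixture \<mu> p0 p1)"
    "KL_divergence (exp 1) (mixture \<mu> p0 p1) (density \<mu> p1) =
     (\<integral>x. relden p1 x * ln (relden p1 x) \<partial>mixture \<mu> p0 p1)"
    using relden_nonneg
    by (simp_all add: density_mixture_relden[symmetric] Q.KL_density log_def)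
qed

text \<open>A divergence vanishes only between equal distributions, and a distribution that equals
  the average of itself and another one equals that other one.\<close>

lemma C_M_pos:
  assumes ne: "density \<mu> p0 \<noteq> density \<mu> p1"
  shows "0 < C_M \<mu> p0 p1"
proof -
  interpret Q: information_space "mixture \<mu> p0 p1" "exp 1"
    using prob_space_mixture by (simp add: information_space_def information_space_axioms_def)
  have emeas: "emeasure (mixture \<mu> p0 p1) A =
      (emeasure (density \<mu> p0) A + emeasure (density \<mu> p1) A) / 2" if A: "A \<in> sets \<mu>" for A
  proof -
    have "emeasure (mixture \<mu> p0 p1) A =
        (\<integral>\<^sup>+x. (ennreal (p0 x) * indicator A x + ennreal (p1 x) * indicator A x) / 2 \<partial>\<mu>)"
      unfolding mixture_def using A nonneg
      by (auto simp: emeasure_density indicator_def divide_ennreal[symmetric] intro!: nn_integral_cong)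
    also have "\<dots> = (emeasure (density \<mu> p0) A + emeasure (density \<mu> p1) A) / 2"
      using A by (simp add: nn_integral_divide nn_integral_add emeasure_density)
    finally show ?thesis .
  qed
  \<comment> \<open>Cancellation in \<open>ennreal\<close> is valid for finite values only, hence
    \<open>fin\<close> below.\<close>
  have half: "x = y" if eq: "x = (x + y) / 2" and fin: "x \<noteq> top" "y \<noteq> top" for x y :: ennreal
  proof -
    obtain r s where rs: "x = ennreal r" "0 \<le> r" "y = ennreal s" "0 \<le> s"
      using fin by (metis ennreal_cases)
    then have "ennreal ((r + s) / 2) = ennreal r"
      using eq divide_ennreal[of "r + s" 2] by simp
    then show ?thesis using rs by simp
  qed
  have fin: "emeasure (density \<mu> p0) A \<noteq> top" "emeasure (density \<mu> p1) A \<noteq> top" for A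
    using finite_measure.emeasure_finite[OF prob_space.finite_measure[OF prob(1)]]
      finite_measure.emeasure_finite[OF prob_space.finite_measure[OF prob(2)]] by auto
  have ne0: "density \<mu> p0 \<noteq> mixture \<mu> p0 p1"
  proof
    assume eq: "density \<mu> p0 = mixture \<mu> p0 p1"
    have "density \<mu> p0 = density \<mu> p1"
    proof (rule measure_eqI)
      fix A assume "A \<in> sets (density \<mu> p0)"
      then have "emeasure (density \<mu> p0) A =
          (emeasure (density \<mu> p0) A + emeasure (density \<mu> p1) A) / 2"
        using emeas[of A] unfolding eq[symmetric] by simp
      then show "emeasure (density \<mu> p0) A = emeasure (density \<mu> p1) A"
        using fin by (rule half)
    qed simp
    then show False using ne by simp
  qed
  have ne1: "density \<mu> p1 \<noteq> mixture \<mu> p0 p1"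
  proof
    assume eq: "density \<mu> p1 = mixture \<mu> p0 p1"
    have "density \<mu> p1 = density \<mu> p0"
    proof (rule measure_eqI)
      fix A assume "A \<in> sets (density \<mu> p1)"
      then have "emeasure (density \<mu> p1) A =
          (emeasure (density \<mu> p1) A + emeasure (density \<mu> p0) A) / 2"
        using emeas[of A] unfolding eq[symmetric] by (simp add: add.commute)
      then show "emeasure (density \<mu> p1) A = emeasure (density \<mu> p0) A"
        using fin(2,1) by (rule half)
    qed simp
    then show False using ne by simp
  qed
  have "0 < KL_divergence (exp 1) (mixture \<mu> p0 p1) (density \<mu> p0)"
    unfolding density_mixture_relden[symmetric] using ne0 prob relden_nonneg integrable_xlnx
    by (intro Q.KL_gt_0) (auto simp: density_mixture_relden log_def)
  moreover have "0 < KL_divergence (exp 1) (mixture \<mu> p0 p1) (density \<mu> p1)"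
    unfolding density_mixture_relden[symmetric] using ne1 prob relden_nonneg integrable_xlnx
    by (intro Q.KL_gt_0) (auto simp: density_mixture_relden log_def)
  ultimately show ?thesis by (simp add: C_M_def)
qed

text \<open>Moves the affinity to the measure over which the divergences are integrals, so that the
  two can be compared pointwise.\<close>

lemma affinity_mixture:
  "affinity = (\<integral>x. sqrt (relden p0 x * relden p1 x) \<partial>mixture \<mu> p0 p1)"
proof -
  have "(\<integral>x. sqrt (relden p0 x * relden p1 x) \<partial>mixture \<mu> p0 p1) =
      (\<integral>x. (p0 x + p1 x) / 2 * sqrt (relden p0 x * relden p1 x) \<partial>\<mu>)"
    unfolding mixture_def using nonneg
    by (subst integral_density) (auto simp: relden_def)
  also have "\<dots> = affinity"
    unfolding affinity_def
  proof (intro Bochner_Integration.integral_cong refl)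
    fix x
    show "(p0 x + p1 x) / 2 * sqrt (relden p0 x * relden p1 x) = sqrt (p0 x * p1 x)"
    proof (cases "p0 x + p1 x = 0")
      case True
      then show ?thesis using nonneg[of x] by (auto simp: add_nonneg_eq_0_iff)
    next
      case False
      then show ?thesis using nonneg[of x]
        by (simp add: relden_def real_sqrt_divide real_sqrt_mult)
    qed
  qed
  finally show ?thesis by simp
qed

text \<open>The minimum of the two divergences is at most their average. Their sum is bounded by
  integrating \<open>xlnx_add_le\<close>, with \<open>u\<close> and \<open>v\<close> the two
  relative densities, whose sum is 2 almost everywhere.\<close>

lemma C_M_le_hellinger: "C_M \<mu> p0 p1 \<le> 3 / 2 * hellinger"
proof -
  interpret Q: prob_space "mixture \<mu> p0 p1" by (rule prob_space_mixture)
  have int: "integrable (mixture \<mu> p0 p1) (\<lambda>x. sqrt (relden p0 x * relden p1 x))"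
  proof (rule Q.integrable_const_bound[where B = 2])
    have "relden p0 x * relden p1 x \<le> 2 * 2" for x
      using relden_nonneg relden_le_2 by (intro mult_mono) auto
    from real_sqrt_le_mono[OF this]
    show "AE x in mixture \<mu> p0 p1. norm (sqrt (relden p0 x * relden p1 x)) \<le> 2"
      using relden_nonneg by simp
  qed auto
  have "2 * C_M \<mu> p0 p1 \<le> (\<integral>x. relden p0 x * ln (relden p0 x) \<partial>mixture \<mu> p0 p1) +
      (\<integral>x. relden p1 x * ln (relden p1 x) \<partial>mixture \<mu> p0 p1)"
    unfolding C_M_def KL_mixture by simp
  also have "\<dots> = (\<integral>x. relden p0 x * ln (relden p0 x) + relden p1 x * ln (relden p1 x) \<partial>mixture \<mu> p0 p1)"
    using integrable_xlnx by simp
  also have "\<dots> \<le> (\<integral>x. 3 * (1 - sqrt (relden p0 x * relden p1 x)) \<partial>mixture \<mu> p0 p1)"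
  proof (rule integral_mono_AE)
    show "AE x in mixture \<mu> p0 p1. relden p0 x * ln (relden p0 x) + relden p1 x * ln (relden p1 x)
        \<le> 3 * (1 - sqrt (relden p0 x * relden p1 x))"
      using AE_mixture_pos
      by eventually_elim (intro xlnx_add_le relden_nonneg relden_sum)
  qed (use int integrable_xlnx in auto)
  also have "\<dots> = 3 * hellinger"
    using int by (simp add: hellinger_def affinity_mixture Q.prob_space)
  finally show ?thesis by simp
qed

end

section \<open>Maxima perturbed by Laplace noise\<close>

lemma sets_Lap [measurable_cong, simp]: "sets (Lap b) = sets borel"
  by (simp add: Lap_def)

lemma space_Lap [simp]: "space (Lap b) = UNIV"
  by (simp add: Lap_def)

lemma emeasure_Lap_atLeast:
  assumes b: "0 < b" and t: "0 \<le> t"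
  shows "emeasure (Lap b) {t..} = ennreal (exp (- t / b) / 2)"
proof -
  have "emeasure (Lap b) {t..} =
      (\<integral>\<^sup>+x. ennreal (1 / (2 * b) * exp (- x / b)) * indicator {t..} x \<partial>lborel)"
    using b t by (auto simp: Lap_def emeasure_density indicator_def intro!: nn_integral_cong)
  also have "\<dots> = ennreal (0 - (- exp (- t / b) / 2))"
  proof (rule nn_integral_FTC_atLeast)
    fix x :: real
    show "((\<lambda>x. - exp (- x / b) / 2) has_real_derivative 1 / (2 * b) * exp (- x / b)) (at x)"
      using b by (auto intro!: derivative_eq_intros)
    show "0 \<le> 1 / (2 * b) * exp (- x / b)"
      using b by simp
  next
    have "((\<lambda>x. - exp (- (x / b)) / 2) \<longlongrightarrow> - 0 / 2) at_top"
      using b by (intro tendsto_intros filterlim_compose[OF exp_at_bot]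
        filterlim_compose[OF filterlim_uminus_at_bot_at_top]
        filterlim_tendsto_pos_mult_at_top[where f = "\<lambda>_. 1 / b" and c = "1 / b" and g = "\<lambda>x. x", simplified]) (auto simp: filterlim_ident)
    then show "((\<lambda>x. - exp (- x / b) / 2) \<longlongrightarrow> 0) at_top" by simp
  qed simp
  finally show ?thesis by simp
qed

lemma emeasure_Lap_uminus:
  assumes [measurable]: "A \<in> sets borel"
  shows "emeasure (Lap b) (uminus -` A) = emeasure (Lap b) A"
proof (cases "b = 0")
  case True
  have "uminus -` A \<in> sets borel"
    using measurable_sets[of uminus borel borel A] assms by simp
  then show ?thesis using True by (simp add: Lap_def indicator_def)
next
  case False
  have [measurable]: "uminus -` A \<in> sets borel"
    using measurable_sets[of uminus borel borel A] assms by simp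
  have "emeasure (Lap b) A = (\<integral>\<^sup>+x. ennreal (1 / (2 * b) * exp (- \<bar>x\<bar> / b)) * indicator A x \<partial>lborel)"
    using False by (simp add: Lap_def emeasure_density)
  also have "\<dots> = (\<integral>\<^sup>+x. ennreal (1 / (2 * b) * exp (- \<bar>x\<bar> / b)) * indicator (uminus -` A) x \<partial>lborel)"
    by (subst nn_integral_real_affine[where c = "-1" and t = 0]) (auto simp: indicator_def)
  also have "\<dots> = emeasure (Lap b) (uminus -` A)"
    using False by (simp add: Lap_def emeasure_density)
  finally show ?thesis by simp
qed

lemma emeasure_Lap_singleton: "0 < b \<Longrightarrow> emeasure (Lap b) {t} = 0"
  by (simp add: Lap_def emeasure_density nn_integral_indicator_singleton)

lemma emeasure_Lap_greaterThan:
  assumes b: "0 < b" and t: "0 \<le> t"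
  shows "emeasure (Lap b) {t<..} = ennreal (exp (- t / b) / 2)"
proof -
  have "emeasure (Lap b) {t..} = emeasure (Lap b) ({t} \<union> {t<..})"
    by (rule arg_cong[where f = "emeasure _"]) auto
  also have "\<dots> = emeasure (Lap b) {t<..}"
    using b by (subst plus_emeasure[symmetric]) (auto simp: emeasure_Lap_singleton)
  finally show ?thesis using emeasure_Lap_atLeast[OF b t] by simp
qed

lemma emeasure_Lap_atMost:
  assumes b: "0 < b" and t: "t \<le> 0"
  shows "emeasure (Lap b) {..t} = ennreal (exp (t / b) / 2)"
proof -
  have "uminus -` {- t..} = {..t}" by auto
  then show ?thesis
    using emeasure_Lap_uminus[of "{- t..}" b] emeasure_Lap_atLeast[of b "- t"] assms by simp
qed

lemma prob_space_Lap:
  assumes b: "0 < b"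
  shows "prob_space (Lap b)"
proof
  have "emeasure (Lap b) (space (Lap b)) = emeasure (Lap b) ({..0} \<union> {0<..})"
    by (rule arg_cong[where f = "emeasure _"]) auto
  also have "\<dots> = emeasure (Lap b) {..0} + emeasure (Lap b) {0<..}"
    by (subst plus_emeasure) auto
  also have "\<dots> = ennreal (1 / 2) + ennreal (1 / 2)"
    using b by (simp add: emeasure_Lap_atMost emeasure_Lap_greaterThan)
  also have "\<dots> = 1"
    by (subst ennreal_plus[symmetric]) auto
  finally show "emeasure (Lap b) (space (Lap b)) = 1" .
qed

section \<open>Winning probabilities of two competing candidates\<close>

text \<open>Here \<open>x\<close> is the noise of \<open>j\<close>, \<open>y\<close> the noise of
  \<open>m\<close>, and \<open>v\<close> stands for the best weighted value among all other
  candidates. The first event says that \<open>m\<close> wins, the second that \<open>j\<close> wins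
  strictly. The factor does not depend on \<open>v\<close>, so the bound survives integration over
  the remaining noise.\<close>

lemma Lap_pair_compare:
  fixes b v aj am \<Delta> :: real
  assumes b: "0 < b" and aj: "0 < aj" and am: "0 \<le> am" and \<Delta>: "0 \<le> \<Delta>"
    and le: "am \<le> exp (- \<Delta>) * aj"
  shows "(\<integral>\<^sup>+y. \<integral>\<^sup>+x. indicator {(x, y). v \<le> am * exp y \<and> aj * exp x \<le> am * exp y} (x, y) \<partial>Lap b \<partial>Lap b)
    \<le> ennreal (4 * exp (- \<Delta> / (2 * b))) *
      (\<integral>\<^sup>+y. \<integral>\<^sup>+x. indicator {(x, y). v < aj * exp x \<and> am * exp y < aj * exp x} (x, y) \<partial>Lap b \<partial>Lap b)"
    (is "?L \<le> ?c * ?R")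
proof -
  interpret prob_space "Lap b" using b by (rule prob_space_Lap)
  have one: "emeasure (Lap b) UNIV = 1"
    using emeasure_space_1 by simp
  have le': "am * exp y \<le> aj * exp (y - \<Delta>)" for y
    using mult_right_mono[OF le, of "exp y"] by (simp add: exp_diff exp_minus field_simps)
  have am_aj: "am \<le> aj"
    using le \<Delta> aj mult_right_mono[of "exp (- \<Delta>)" 1 aj] by (auto intro: order_trans)
  show ?thesis
  proof (cases "v \<le> aj")
    \<comment> \<open>If \<open>v \<le> aj\<close>, a win of \<open>m\<close> needs
      \<open>y - x \<ge> \<Delta>\<close>, so \<open>y \<ge> \<Delta> / 2\<close> or
      \<open>x \<le> - \<Delta> / 2\<close>. The event \<open>y \<le> 0 < x\<close>, of probability
      1/4, already makes \<open>j\<close> win; this is the origin of the factor 4.\<close>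
    case True
    have "?L \<le> (\<integral>\<^sup>+y. \<integral>\<^sup>+x. indicator {\<Delta> / 2..} y + indicator {..- (\<Delta> / 2)} x \<partial>Lap b \<partial>Lap b)"
    proof (intro nn_integral_mono)
      fix x y
      have "\<Delta> / 2 \<le> y \<or> x \<le> - (\<Delta> / 2)" if "aj * exp x \<le> am * exp y"
      proof -
        have "aj * exp x \<le> aj * exp (y - \<Delta>)" using that le'[of y] by linarith
        then have "x \<le> y - \<Delta>" using aj by simp
        then show ?thesis by linarith
      qed
      then show "indicator {(x, y). v \<le> am * exp y \<and> aj * exp x \<le> am * exp y} (x, y)
          \<le> (indicator {\<Delta> / 2..} y + indicator {..- (\<Delta> / 2)} x :: ennreal)"
        by (auto simp: indicator_def)
    qed
    also have "\<dots> = emeasure (Lap b) {\<Delta> / 2..} + emeasure (Lap b) {..- (\<Delta> / 2)}"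
      by (simp add: nn_integral_add one)
    also have "\<dots> = ennreal (exp (- \<Delta> / (2 * b)))"
      using b \<Delta> by (simp add: emeasure_Lap_atLeast emeasure_Lap_atMost ennreal_plus[symmetric] field_simps del: ennreal_plus)
    also have "\<dots> = ?c * ennreal (1 / 4)"
      by (subst ennreal_mult[symmetric]) auto
    also have "ennreal (1 / 4) = (\<integral>\<^sup>+y. \<integral>\<^sup>+x. indicator {..0} y * indicator {0<..} x \<partial>Lap b \<partial>Lap b)"
    proof -
      have "ennreal (1 / 4) = ennreal (1 / 2) * ennreal (1 / 2)"
        by (subst ennreal_mult[symmetric]) auto
      also have "\<dots> = emeasure (Lap b) {..0} * emeasure (Lap b) {0<..}"
        using b by (simp add: emeasure_Lap_atMost emeasure_Lap_greaterThan)
      finally show ?thesis by (simp add: nn_integral_cmult nn_integral_multc)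
    qed
    also have "?c * \<dots> \<le> ?c * ?R"
    proof (intro mult_left_mono nn_integral_mono)
      fix x y :: real
      have "v < aj * exp x \<and> am * exp y < aj * exp x" if "y \<le> 0" "0 < x"
      proof -
        have "aj * 1 < aj * exp x" using aj that by (intro mult_strict_left_mono) auto
        moreover have "am * exp y \<le> aj * 1" using am am_aj that aj by (intro mult_mono) auto
        ultimately show ?thesis using True by linarith
      qed
      then show "indicator {..0} y * indicator {0<..} x
          \<le> (indicator {(x, y). v < aj * exp x \<and> am * exp y < aj * exp x} (x, y) :: ennreal)"
        by (auto simp: indicator_def)
    qed simp
    finally show ?thesis .
  next
    case False
    \<comment> \<open>The noise that \<open>j\<close> has to exceed in order to beat
      \<open>v\<close>. A win of \<open>m\<close> now needs \<open>y \<ge> u + \<Delta>\<close>,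
      whereas \<open>y \<le> u < x\<close> suffices for \<open>j\<close>. The common factor
      \<open>exp (- u / b)\<close> of both probabilities cancels.\<close>
    define u where "u = ln (v / aj)"
    have u: "0 < u" "v = aj * exp u"
      using False aj by (auto simp: u_def)
    have "?L \<le> (\<integral>\<^sup>+y. \<integral>\<^sup>+x. indicator {u + \<Delta>..} y \<partial>Lap b \<partial>Lap b)"
    proof (intro nn_integral_mono)
      fix x y :: real
      have "u + \<Delta> \<le> y" if "v \<le> am * exp y"
      proof -
        have "aj * exp u \<le> aj * exp (y - \<Delta>)" using that le'[of y] u by linarith
        then show ?thesis using aj by simp
      qed
      then show "indicator {(x, y). v \<le> am * exp y \<and> aj * exp x \<le> am * exp y} (x, y)
          \<le> (indicator {u + \<Delta>..} y :: ennreal)"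
        by (auto simp: indicator_def)
    qed
    also have "\<dots> = ennreal (exp (- (u + \<Delta>) / b) / 2)"
      using b u \<Delta> by (simp add: one emeasure_Lap_atLeast)
    also have "\<dots> \<le> ennreal (4 * exp (- \<Delta> / (2 * b)) * (1 / 2 * (exp (- u / b) / 2)))"
    proof (rule ennreal_leI)
      have "exp (- (u + \<Delta>) / b) = exp (- u / b) * exp (- \<Delta> / b)"
        by (simp add: exp_add[symmetric] add_divide_distrib[symmetric] diff_divide_distrib)
      also have "\<dots> \<le> exp (- u / b) * exp (- \<Delta> / (2 * b))"
        using b \<Delta> by (intro mult_left_mono) (auto simp: field_simps)
      finally have "exp (- (u + \<Delta>) / b) / 2 \<le> exp (- u / b) * exp (- \<Delta> / (2 * b))"
        using exp_ge_zero[of "- (u + \<Delta>) / b"] by linarith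
      then show "exp (- (u + \<Delta>) / b) / 2 \<le> 4 * exp (- \<Delta> / (2 * b)) * (1 / 2 * (exp (- u / b) / 2))"
        by (simp add: mult.commute)
    qed
    also have "\<dots> = ?c * (ennreal (1 / 2) * ennreal (exp (- u / b) / 2))"
      using ennreal_mult[of "4 * exp (- \<Delta> / (2 * b))" "1 / 2 * (exp (- u / b) / 2)"]
        ennreal_mult[of "1 / 2" "exp (- u / b) / 2"] by simp
    also have "\<dots> \<le> ?c * (emeasure (Lap b) {..u} * emeasure (Lap b) {u<..})"
    proof (intro mult_left_mono mult_mono)
      have "ennreal (1 / 2) = emeasure (Lap b) {..0}"
        using b by (simp add: emeasure_Lap_atMost)
      also have "\<dots> \<le> emeasure (Lap b) {..u}"
        using u by (intro emeasure_mono) auto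
      finally show "ennreal (1 / 2) \<le> emeasure (Lap b) {..u}" .
    qed (use b u in \<open>auto simp: emeasure_Lap_greaterThan\<close>)
    also have "emeasure (Lap b) {..u} * emeasure (Lap b) {u<..} =
        (\<integral>\<^sup>+y. \<integral>\<^sup>+x. indicator {..u} y * indicator {u<..} x \<partial>Lap b \<partial>Lap b)"
      by (simp add: nn_integral_cmult nn_integral_multc)
    also have "?c * \<dots> \<le> ?c * ?R"
    proof (intro mult_left_mono nn_integral_mono)
      fix x y :: real
      have "v < aj * exp x \<and> am * exp y < aj * exp x" if "y \<le> u" "u < x"
      proof -
        have "aj * exp u < aj * exp x" using aj that by (intro mult_strict_left_mono) auto
        moreover have "am * exp y \<le> aj * exp u" using am am_aj that aj by (intro mult_mono) auto
        ultimately show ?thesis using u by linarith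
      qed
      then show "indicator {..u} y * indicator {u<..} x
          \<le> (indicator {(x, y). v < aj * exp x \<and> am * exp y < aj * exp x} (x, y) :: ennreal)"
        by (auto simp: indicator_def)
    qed simp
    finally show ?thesis .
  qed
qed

lemma sets_argmax:
  fixes a :: "'i \<Rightarrow> real" and b :: real
  assumes I: "finite I" "k \<in> I"
  defines "P \<equiv> Pi\<^sub>M I (\<lambda>_. Lap b)"
  shows "{z \<in> space P. \<forall>i\<in>I. a i * exp (z i) \<le> a k * exp (z k)} \<in> sets P"
    and "{z \<in> space P. \<forall>i\<in>I - {k}. a i * exp (z i) < a k * exp (z k)} \<in> sets P"
proof -
  have comp: "(\<lambda>z. z i) \<in> borel_measurable P" if "i \<in> I" for i
    using measurable_component_singleton[OF that, of "\<lambda>_. Lap b"] unfolding P_def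
    by (simp cong: measurable_cong_sets)
  have "{z \<in> space P. a i * exp (z i) \<le> a k * exp (z k)} \<in> sets P"
    "{z \<in> space P. a i * exp (z i) < a k * exp (z k)} \<in> sets P" if "i \<in> I" for i
  proof -
    note [measurable] = comp[OF that] comp[OF I(2)]
    show "{z \<in> space P. a i * exp (z i) \<le> a k * exp (z k)} \<in> sets P"
      "{z \<in> space P. a i * exp (z i) < a k * exp (z k)} \<in> sets P" by measurable
  qed
  then show "{z \<in> space P. \<forall>i\<in>I. a i * exp (z i) \<le> a k * exp (z k)} \<in> sets P"
    "{z \<in> space P. \<forall>i\<in>I - {k}. a i * exp (z i) < a k * exp (z k)} \<in> sets P"
    using I by (auto intro!: sets.sets_Collect_finite_All)
qed

text \<open>By Fubini all noise coordinates except those of \<open>j\<close> and \<open>m\<close>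
  are fixed, and \<open>Lap_pair_compare\<close> is applied to these two. Ties are allowed on the
  left, since they may be broken in favour of \<open>m\<close>. The right-hand event is strict, so
  that such events are disjoint for different \<open>j\<close>.\<close>

lemma Lap_argmax_compare:
  fixes a :: "'i \<Rightarrow> real" and b \<Delta> :: real
  assumes b: "0 < b" and I: "finite I" "j \<in> I" "m \<in> I" "j \<noteq> m" and a: "\<And>i. 0 \<le> a i"
    and aj: "0 < a j" and \<Delta>: "0 \<le> \<Delta>" and le: "a m \<le> exp (- \<Delta>) * a j"
  defines "P \<equiv> Pi\<^sub>M I (\<lambda>_. Lap b)"
  shows "emeasure P {z \<in> space P. \<forall>i\<in>I. a i * exp (z i) \<le> a m * exp (z m)}
    \<le> ennreal (4 * exp (- \<Delta> / (2 * b))) *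
      emeasure P {z \<in> space P. \<forall>i\<in>I - {j}. a i * exp (z i) < a j * exp (z j)}"
    (is "emeasure P ?W \<le> ?c * emeasure P ?V")
proof (cases "a m = 0")
  case True
  \<comment> \<open>A zero weight stays zero under any noise and cannot reach the positive weight of
    \<open>j\<close>.\<close>
  have "?W = {}"
    using I aj by (auto simp: True mult_le_0_iff not_le intro!: bexI[of _ j])
  then show ?thesis by (simp only: emeasure_empty zero_le)
next
  case False
  then have am: "0 < a m" using a[of m] by simp
  interpret L: prob_space "Lap b" using b by (rule prob_space_Lap)
  interpret prod: product_sigma_finite "\<lambda>_. Lap b" by unfold_locales
  define R where "R = I - {j, m}"
  have I_eq: "I = insert j (insert m R)" and R: "finite R" "m \<notin> R" "j \<notin> insert m R"
    using I by (auto simp: R_def)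
  have iterated: "(\<integral>\<^sup>+z. f z \<partial>P) =
      (\<integral>\<^sup>+z. \<integral>\<^sup>+y. \<integral>\<^sup>+x. f (z(m := y, j := x)) \<partial>Lap b \<partial>Lap b \<partial>Pi\<^sub>M R (\<lambda>_. Lap b))"
    if f: "f \<in> borel_measurable P" for f :: "('i \<Rightarrow> real) \<Rightarrow> ennreal"
  proof -
    have [measurable]: "f \<in> borel_measurable (Pi\<^sub>M (insert j (insert m R)) (\<lambda>_. Lap b))"
      using f by (simp add: P_def I_eq)
    have "(\<integral>\<^sup>+z. f z \<partial>P) = (\<integral>\<^sup>+z. \<integral>\<^sup>+x. f (z(j := x)) \<partial>Lap b \<partial>Pi\<^sub>M (insert m R) (\<lambda>_. Lap b))"
      unfolding P_def I_eq using R by (subst prod.product_nn_integral_insert) auto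
    also have "\<dots> = (\<integral>\<^sup>+z. \<integral>\<^sup>+y. \<integral>\<^sup>+x. f (z(m := y, j := x)) \<partial>Lap b \<partial>Lap b \<partial>Pi\<^sub>M R (\<lambda>_. Lap b))"
      using R by (subst prod.product_nn_integral_insert) auto
    finally show ?thesis .
  qed
  have [measurable]: "?W \<in> sets P" "?V \<in> sets P"
    unfolding P_def using I by (auto intro!: sets_argmax)
  have "emeasure P ?W = (\<integral>\<^sup>+z. indicator ?W z \<partial>P)"
    by simp
  also have "\<dots> \<le> (\<integral>\<^sup>+z. ?c * indicator ?V z \<partial>P)"
  proof (subst (1 2) iterated)
    show "(\<integral>\<^sup>+z. \<integral>\<^sup>+y. \<integral>\<^sup>+x. indicator ?W (z(m := y, j := x)) \<partial>Lap b \<partial>Lap b \<partial>Pi\<^sub>M R (\<lambda>_. Lap b))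
      \<le> (\<integral>\<^sup>+z. \<integral>\<^sup>+y. \<integral>\<^sup>+x. ?c * indicator ?V (z(m := y, j := x)) \<partial>Lap b \<partial>Lap b \<partial>Pi\<^sub>M R (\<lambda>_. Lap b))"
    proof (rule nn_integral_mono)
      fix z assume z: "z \<in> space (Pi\<^sub>M R (\<lambda>_. Lap b))"
      \<comment> \<open>The inserted 0 keeps \<open>Max\<close> meaningful for empty
        \<open>R\<close>; it is harmless because \<open>v\<close> is compared with positive values
        only.\<close>
      define v where "v = Max (insert 0 ((\<lambda>i. a i * exp (z i)) ` R))"
      have v_le: "v \<le> t \<longleftrightarrow> (\<forall>i\<in>R. a i * exp (z i) \<le> t)" if "0 < t" for t
        using R that by (auto simp: v_def)
      have v_less: "v < t \<longleftrightarrow> (\<forall>i\<in>R. a i * exp (z i) < t)" if "0 < t" for t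
        using R that by (auto simp: v_def)
      have upd: "z(m := y, j := x) \<in> space P" for x y
        using z by (auto simp: P_def I_eq space_PiM PiE_def extensional_def)
      have neq: "i \<noteq> j" "i \<noteq> m" if "i \<in> R" for i
        using that by (auto simp: R_def)
      have "(\<forall>i\<in>I. a i * exp ((z(m := y, j := x)) i) \<le> a m * exp ((z(m := y, j := x)) m)) \<longleftrightarrow>
          v \<le> a m * exp y \<and> a j * exp x \<le> a m * exp y" for x y
        using am I(4) neq by (auto simp: I_eq v_le)
      then have W: "indicator ?W (z(m := y, j := x)) =
          (indicator {(x, y). v \<le> a m * exp y \<and> a j * exp x \<le> a m * exp y} (x, y) :: ennreal)" for x y
        using upd by (simp add: indicator_def)
      define S where "S = {(x, y). v < a j * exp x \<and> a m * exp y < a j * exp x}"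
      have "{p \<in> space (borel \<Otimes>\<^sub>M borel). v < a j * exp (fst p) \<and> a m * exp (snd p) < a j * exp (fst p)}
          \<in> sets (borel \<Otimes>\<^sub>M borel)"
        by measurable
      then have [measurable]: "S \<in> sets (borel \<Otimes>\<^sub>M borel)"
        by (simp add: S_def space_pair_measure case_prod_beta')
      have "(\<forall>i\<in>I - {j}. a i * exp ((z(m := y, j := x)) i) < a j * exp ((z(m := y, j := x)) j)) \<longleftrightarrow>
          v < a j * exp x \<and> a m * exp y < a j * exp x" for x y
        using aj I(4) neq by (auto simp: I_eq v_less)
      then have V: "indicator ?V (z(m := y, j := x)) =
          (indicator S (x, y) :: ennreal)" for x y
        using upd by (simp add: S_def indicator_def)
      have "(\<integral>\<^sup>+y. \<integral>\<^sup>+x. indicator ?W (z(m := y, j := x)) \<partial>Lap b \<partial>Lap b) \<le> ?c * (\<integral>\<^sup>+y. \<integral>\<^sup>+x.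
          indicator S (x, y) \<partial>Lap b \<partial>Lap b)"
        unfolding W S_def by (rule Lap_pair_compare) (use b aj a \<Delta> le in auto)
      also have "\<dots> = (\<integral>\<^sup>+y. ?c * (\<integral>\<^sup>+x.
          indicator S (x, y) \<partial>Lap b) \<partial>Lap b)"
        by (intro nn_integral_cmult[symmetric] L.borel_measurable_nn_integral) measurable
      also have "\<dots> = (\<integral>\<^sup>+y. \<integral>\<^sup>+x. ?c * indicator ?V (z(m := y, j := x)) \<partial>Lap b \<partial>Lap b)"
        unfolding V by (intro nn_integral_cong nn_integral_cmult[symmetric]) measurable
      finally show "(\<integral>\<^sup>+y. \<integral>\<^sup>+x. indicator ?W (z(m := y, j := x)) \<partial>Lap b \<partial>Lap b)
        \<le> (\<integral>\<^sup>+y. \<integral>\<^sup>+x. ?c * indicator ?V (z(m := y, j := x)) \<partial>Lap b \<partial>Lap b)" .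
    qed
  qed measurable
  also have "\<dots> = ?c * emeasure P ?V"
    by (simp add: nn_integral_cmult)
  finally show ?thesis .
qed

section \<open>Summation over all far candidates\<close>

text \<open>Quotient and remainder determine \<open>d\<close>, so the sum is at most the product of
  a geometric series over the quotients and the sum of \<open>p\<close> over the remainders.\<close>

lemma sum_power_div_mod_le:
  fixes q :: real and p :: "nat \<Rightarrow> real"
  assumes q: "0 \<le> q" "q < 1" and p: "\<And>j. 0 \<le> p j" and D: "D \<subseteq> {w..N}" and w: "0 < w"
    and sum: "(\<Sum>j\<in>{j. j < w \<and> j \<le> N}. p j) \<le> 1"
  shows "(\<Sum>d\<in>D. q ^ (d div w) * p (d mod w)) \<le> q / (1 - q)"
proof -
  let ?J = "{j. j < w \<and> j \<le> N}" and ?\<phi> = "\<lambda>d. (d div w, d mod w)"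
  have inj: "inj_on ?\<phi> D"
    by (rule inj_onI) (metis Pair_inject div_mult_mod_eq)
  have sub: "?\<phi> ` D \<subseteq> {1..N} \<times> ?J"
  proof
    fix e assume "e \<in> ?\<phi> ` D"
    then obtain d where d: "d \<in> D" "e = ?\<phi> d" by auto
    then have wd: "w \<le> d" "d \<le> N" using D by auto
    \<comment> \<open>As \<open>d \<ge> w\<close>, the quotient 0 does not occur; the series starts
      with \<open>q\<close> and is small when \<open>q\<close> is.\<close>
    then have "1 \<le> d div w" using w by (simp add: div_greater_zero_iff Suc_le_eq)
    then show "e \<in> {1..N} \<times> ?J"
      using d wd w by (auto intro: order_trans[OF div_le_dividend] order_trans[OF mod_less_eq_dividend])
  qed
  have "(\<Sum>d\<in>D. q ^ (d div w) * p (d mod w)) = (\<Sum>(i, j)\<in>?\<phi> ` D. q ^ i * p j)"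
    using inj by (subst sum.reindex) auto
  also have "\<dots> \<le> (\<Sum>(i, j)\<in>{1..N} \<times> ?J. q ^ i * p j)"
    using sub q p by (intro sum_mono2) auto
  also have "\<dots> = (\<Sum>i=1..N. q ^ i) * (\<Sum>j\<in>?J. p j)"
    by (simp add: sum.cartesian_product[symmetric] sum_product)
  also have "\<dots> \<le> (\<Sum>i=1..N. q ^ i) * 1"
    using sum q by (intro mult_left_mono sum_nonneg) auto
  also have "(\<Sum>i=1..N. q ^ i) * 1 = q * (\<Sum>i<N. q ^ i)"
    by (simp add: sum_distrib_left sum.atLeast1_atMost_eq)
  also have "\<dots> \<le> q * (1 / (1 - q))"
  proof (rule mult_left_mono)
    have "(\<Sum>i<N. q ^ i) \<le> (\<Sum>i. q ^ i)"
      using q by (intro sum_le_suminf summable_geometric) auto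
    then show "(\<Sum>i<N. q ^ i) \<le> 1 / (1 - q)"
      using q by (simp add: suminf_geometric)
  qed (use q in auto)
  finally show ?thesis by simp
qed

text \<open>\<open>c d\<close> is the candidate at distance \<open>d\<close> from the centre \<open>c 0\<close>.\<close>
lemma Lap_argmax_far:
  fixes a :: "nat \<Rightarrow> real" and c :: "nat \<Rightarrow> nat" and b \<gamma> :: real
  assumes b: "0 < b" and \<gamma>: "0 < \<gamma>" and I: "finite I" and a: "\<And>i. 0 \<le> a i"
    and pos: "\<exists>i\<in>I. 0 < a i"
    and c: "inj_on c {..N}" "c ` {..N} \<subseteq> I" and D: "D \<subseteq> {w..N}" and w: "0 < w"
    and le: "\<And>d. d \<in> D \<Longrightarrow> a (c d) \<le> exp (- \<gamma> * (d div w)) * a (c (d mod w))"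
  defines "P \<equiv> Pi\<^sub>M I (\<lambda>_. Lap b)"
  shows "measure P {z \<in> space P. \<exists>d\<in>D. \<forall>i\<in>I. a i * exp (z i) \<le> a (c d) * exp (z (c d))}
    \<le> 4 * (exp (- \<gamma> / (2 * b)) / (1 - exp (- \<gamma> / (2 * b))))"
proof -
  interpret L: prob_space "Lap b" using b by (rule prob_space_Lap)
  interpret P: prob_space P unfolding P_def by (intro prob_space_PiM) unfold_locales
  define q where "q = exp (- \<gamma> / (2 * b))"
  have q: "0 \<le> q" "q < 1" using b \<gamma> by (auto simp: q_def)
  define W where "W d = {z \<in> space P. \<forall>i\<in>I. a i * exp (z i) \<le> a (c d) * exp (z (c d))}" for d
  define V where "V j = {z \<in> space P. \<forall>i\<in>I - {c j}. a i * exp (z i) < a (c j) * exp (z (c j))}" for j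
  have W_sets: "W d \<in> sets P" and V_sets: "V d \<in> sets P" if "d \<le> N" for d
    unfolding W_def V_def P_def using c I that by (auto intro!: sets_argmax)
  have W_le: "measure P (W d) \<le> 4 * (q ^ (d div w) * measure P (V (d mod w)))" if d: "d \<in> D" for d
  proof (cases "a (c (d mod w)) = 0")
    case True
    \<comment> \<open>If the near partner has weight zero, so does the far candidate, which then
      loses to the positive weight given by \<open>pos\<close>.\<close>
    then have "a (c d) = 0" using le[OF d] a[of "c d"] by simp
    then have "W d = {}" using pos by (auto simp: W_def mult_le_0_iff not_le)
    then show ?thesis using q by simp
  next
    case False
    have wd: "w \<le> d" "d \<le> N" using D d by auto
    have dm: "d mod w \<le> N" "d mod w < w" using wd w by (auto intro: order_trans[OF mod_less_eq_dividend])
    have "c (d mod w) \<noteq> c d"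
      using inj_onD[OF c(1), of "d mod w" d] dm wd by auto
    moreover have "c (d mod w) \<in> I" "c d \<in> I" using c dm wd by auto
    moreover have "0 < a (c (d mod w))" using False a[of "c (d mod w)"] by simp
    \<comment> \<open>The gap is \<open>\<Delta> = \<gamma> * (d div w)\<close>: each further block
      of \<open>w\<close> steps contributes one more factor \<open>q\<close>.\<close>
    ultimately have "emeasure P (W d) \<le> ennreal (4 * exp (- (\<gamma> * (d div w)) / (2 * b))) * emeasure P (V (d mod w))"
      unfolding W_def V_def P_def using b I a \<gamma> le[OF d]
      by (intro Lap_argmax_compare) auto
    also have "exp (- (\<gamma> * (d div w)) / (2 * b)) = q ^ (d div w)"
      by (simp add: q_def exp_of_nat_mult[symmetric])
    finally have "ennreal (measure P (W d)) \<le> ennreal (4 * q ^ (d div w) * measure P (V (d mod w)))"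
      using q by (simp add: P.emeasure_eq_measure ennreal_mult)
    then show ?thesis using q by (subst (asm) ennreal_le_iff) auto
  qed
  \<comment> \<open>Two candidates cannot both win strictly. Hence the near winning probabilities
    add up to at most 1, and neither \<open>w\<close> nor \<open>N\<close> enters the final bound as
    a factor.\<close>
  have disj: "disjoint_family_on V {..N}"
  proof (unfold disjoint_family_on_def, intro ballI impI)
    fix i j assume ij: "i \<in> {..N}" "j \<in> {..N}" "i \<noteq> j"
    then have "c i \<in> I" "c j \<in> I" "c i \<noteq> c j" using c by (auto simp: inj_on_def)
    show "V i \<inter> V j = {}"
    proof (rule equals0I)
      fix z assume "z \<in> V i \<inter> V j"
      then have "a (c j) * exp (z (c j)) < a (c i) * exp (z (c i))"
        "a (c i) * exp (z (c i)) < a (c j) * exp (z (c j))"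
        using \<open>c i \<in> I\<close> \<open>c j \<in> I\<close> \<open>c i \<noteq> c j\<close> by (auto simp: V_def)
      then show False by simp
    qed
  qed
  have "(\<Sum>j\<in>{j. j < w \<and> j \<le> N}. measure P (V j)) = measure P (\<Union>j\<in>{j. j < w \<and> j \<le> N}. V j)"
    using V_sets disj
    by (intro P.finite_measure_finite_Union[symmetric]) (auto simp: disjoint_family_on_def)
  then have V_sum: "(\<Sum>j\<in>{j. j < w \<and> j \<le> N}. measure P (V j)) \<le> 1" by simp
  have finD: "finite D" using D by (rule finite_subset) simp
  have "measure P {z \<in> space P. \<exists>d\<in>D. \<forall>i\<in>I. a i * exp (z i) \<le> a (c d) * exp (z (c d))} = measure P (\<Union>d\<in>D. W d)"
    by (rule arg_cong[where f = "measure P"]) (auto simp: W_def)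
  also have "\<dots> \<le> (\<Sum>d\<in>D. measure P (W d))"
    using finD D W_sets by (intro P.finite_measure_subadditive_finite) auto
  also have "\<dots> \<le> (\<Sum>d\<in>D. 4 * (q ^ (d div w) * measure P (V (d mod w))))"
    by (intro sum_mono W_le)
  also have "\<dots> = 4 * (\<Sum>d\<in>D. q ^ (d div w) * measure P (V (d mod w)))"
    by (simp add: sum_distrib_left)
  also have "\<dots> \<le> 4 * (q / (1 - q))"
    using q D w V_sum by (intro mult_left_mono sum_power_div_mod_le[where N = N]) auto
  finally show ?thesis by (simp add: q_def)
qed

section \<open>Likelihoods of the candidates\<close>

text \<open>A geometric series starting at the ceiling of \<open>\<alpha>\<close>. The factor
  \<open>2 / \<kappa>\<close> bounds \<open>1 / (1 - exp (- \<kappa>))\<close>, because \<open>exp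
  (- \<kappa>) \<le> 1 / (1 + \<kappa>) \<le> 1 - \<kappa> / 2\<close> for \<open>\<kappa>\<close>
  in \<open>(0, 1]\<close>.\<close>

lemma sum_exp_tail_le:
  fixes \<kappa> \<alpha> :: real and D :: "nat set"
  assumes \<kappa>: "0 < \<kappa>" "\<kappa> \<le> 1" and D: "finite D" "\<And>d. d \<in> D \<Longrightarrow> \<alpha> \<le> d"
  shows "(\<Sum>d\<in>D. exp (- \<kappa> * d)) \<le> 2 / \<kappa> * exp (- \<kappa> * \<alpha>)"
proof -
  define q where "q = exp (- \<kappa>)"
  have "exp (- \<kappa>) \<le> 1 / (1 + \<kappa>)"
    using exp_ge_add_one_self[of \<kappa>] \<kappa> by (simp add: exp_minus field_simps)
  also have "\<dots> \<le> 1 - \<kappa> / 2"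
  proof -
    have "\<kappa> * \<kappa> \<le> \<kappa>" using \<kappa> by (simp add: mult_left_le)
    then show ?thesis using \<kappa> by (simp add: field_simps)
  qed
  finally have q: "0 < q" "q \<le> 1 - \<kappa> / 2" by (auto simp: q_def)
  then have q1: "q < 1" using \<kappa> by simp
  \<comment> \<open>For negative \<open>\<alpha>\<close> this is 0, which still lies above
    \<open>\<alpha>\<close> and below every element of \<open>D\<close>.\<close>
  define m where "m = nat \<lceil>\<alpha>\<rceil>"
  have m: "\<alpha> \<le> m" by (simp add: m_def real_nat_ceiling_ge)
  have D_le: "m \<le> d" if "d \<in> D" for d
    using D(2)[OF that] by (simp add: m_def ceiling_le_iff nat_le_iff)
  have inj: "inj_on (\<lambda>d. d - m) D"
    using D_le by (auto intro!: inj_onI dest: eq_diff_iff)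
  have "(\<Sum>d\<in>D. exp (- \<kappa> * d)) = (\<Sum>d\<in>D. q ^ m * q ^ (d - m))"
  proof (intro sum.cong refl)
    fix d assume "d \<in> D"
    then have "q ^ m * q ^ (d - m) = q ^ d"
      using D_le by (simp add: power_add[symmetric])
    then show "exp (- \<kappa> * d) = q ^ m * q ^ (d - m)"
      by (simp add: q_def exp_of_nat_mult[symmetric] mult.commute)
  qed
  also have "\<dots> = q ^ m * (\<Sum>i\<in>(\<lambda>d. d - m) ` D. q ^ i)"
    using inj by (simp add: sum_distrib_left sum.reindex)
  also have "\<dots> \<le> q ^ m * (\<Sum>i. q ^ i)"
    using q q1 D by (intro mult_left_mono sum_le_suminf summable_geometric) auto
  also have "\<dots> = q ^ m * (1 / (1 - q))"
    using q q1 by (simp add: suminf_geometric)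
  also have "\<dots> \<le> exp (- \<kappa> * \<alpha>) * (2 / \<kappa>)"
  proof (rule mult_mono)
    have "q ^ m = exp (- \<kappa> * m)"
      by (simp add: q_def exp_of_nat_mult[symmetric] mult.commute)
    also have "\<dots> \<le> exp (- \<kappa> * \<alpha>)" using m \<kappa> by simp
    finally show "q ^ m \<le> exp (- \<kappa> * \<alpha>)" .
    have "1 / (1 - q) \<le> 1 / (\<kappa> / 2)"
      using q \<kappa> q1 by (intro divide_left_mono) auto
    then show "1 / (1 - q) \<le> 2 / \<kappa>" by simp
  qed (use q1 in auto)
  finally show ?thesis by (simp add: mult.commute)
qed

text \<open>Two candidates disagree only about the observations between them; \<open>a\<close> is
  the common factor that cancels in likelihood ratios.\<close>

lemma lik_shift:
  fixes p0 p1 :: "real \<Rightarrow> real" and x :: "nat \<Rightarrow> real"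
  assumes "1 \<le> j" "j \<le> k" "k \<le> n"
  defines "a \<equiv> (\<Prod>i=1..<j. p0 (x i)) * (\<Prod>i=k..n. p1 (x i))"
  shows "lik p0 p1 n x j = a * (\<Prod>i=j..<k. p1 (x i))"
    and "lik p0 p1 n x k = a * (\<Prod>i=j..<k. p0 (x i))"
proof -
  have "(\<Prod>i=1..<k. p0 (x i)) = (\<Prod>i=1..<j. p0 (x i)) * (\<Prod>i=j..<k. p0 (x i))"
    using assms(1,2) by (subst prod.union_disjoint[symmetric]) (auto simp: ivl_disj_un)
  moreover have "(\<Prod>i=j..n. p1 (x i)) = (\<Prod>i=j..<k. p1 (x i)) * (\<Prod>i=k..n. p1 (x i))"
    using assms(2,3) by (subst prod.union_disjoint[symmetric]) (auto simp: ivl_disj_un)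
  ultimately show "lik p0 p1 n x j = a * (\<Prod>i=j..<k. p1 (x i))"
    "lik p0 p1 n x k = a * (\<Prod>i=j..<k. p0 (x i))"
    by (simp_all add: lik_def a_def)
qed

section \<open>The change-point model and tails of likelihood ratios\<close>

locale change_point = density_pair \<mu> p0 p1 + prob_space M
  for \<mu> :: "real measure" and p0 p1 :: "real \<Rightarrow> real" and M :: "'a measure" +
  fixes X :: "nat \<Rightarrow> 'a \<Rightarrow> real" and n kstar :: nat
  assumes kstar: "1 < kstar" "kstar < n"
    and data: "change_point_data M \<mu> p0 p1 n kstar X"
begin

lemma indep: "indep_vars (\<lambda>_. borel) X {1..n}"
  and distr_before: "i \<in> {1..<kstar} \<Longrightarrow> distr M borel (X i) = density \<mu> p0"
  and distr_after: "i \<in> {kstar..n} \<Longrightarrow> distr M borel (X i) = density \<mu> p1"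
  using data by (auto simp: change_point_data_def)

lemma X_meas: "i \<in> {1..n} \<Longrightarrow> X i \<in> borel_measurable M"
  using indep by (auto simp: indep_vars_def)

lemma sets_prod_le:
  fixes p p' :: "real \<Rightarrow> real" and t :: real
  assumes I: "I \<subseteq> {1..n}"
    and [measurable]: "p \<in> borel_measurable borel" "p' \<in> borel_measurable borel"
  shows "{\<omega> \<in> space M. t * (\<Prod>i\<in>I. p (X i \<omega>)) \<le> (\<Prod>i\<in>I. p' (X i \<omega>))} \<in> sets M"
proof -
  have [measurable]: "X i \<in> borel_measurable M" if "i \<in> I" for i
    using I that X_meas by auto
  show ?thesis by measurable
qed

text \<open>An observation almost surely avoids the zeros of its own density. This permits division
  by likelihoods and makes the likelihood of the true change point positive.\<close>

lemma AE_all_pos: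
  fixes p :: "real \<Rightarrow> real"
  assumes I: "I \<subseteq> {1..n}" and distr: "\<And>i. i \<in> I \<Longrightarrow> distr M borel (X i) = density \<mu> p"
    and [measurable]: "p \<in> borel_measurable borel" and p: "\<And>x. 0 \<le> p x"
  shows "AE \<omega> in M. \<forall>i\<in>I. 0 < p (X i \<omega>)"
proof (subst AE_finite_all)
  show "finite I" using I by (rule finite_subset) simp
  show "\<forall>i\<in>I. AE \<omega> in M. 0 < p (X i \<omega>)"
  proof
    fix i assume i: "i \<in> I"
    have "AE x in density \<mu> p. 0 < p x"
      by (subst AE_density) (auto simp: ennreal_less_zero_iff)
    then have "AE x in distr M borel (X i). 0 < p x"
      by (simp only: distr[OF i])
    then show "AE \<omega> in M. 0 < p (X i \<omega>)"
      using X_meas[of i] i I by (subst (asm) AE_distr_iff) auto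
  qed
qed

text \<open>Markov's inequality for the square root of the likelihood ratio.\<close>
lemma prod_ratio_tail:
  fixes p p' :: "real \<Rightarrow> real" and \<tau> :: real
  assumes I: "I \<subseteq> {1..n}" and distr: "\<And>i. i \<in> I \<Longrightarrow> distr M borel (X i) = density \<mu> p"
    and [measurable]: "p \<in> borel_measurable borel" "p' \<in> borel_measurable borel"
    and p: "\<And>x. 0 \<le> p x" and p': "\<And>x. 0 \<le> p' x"
    and aff: "(\<integral>\<^sup>+x. ennreal (sqrt (p x * p' x)) \<partial>\<mu>) = ennreal affinity"
  shows "prob {\<omega> \<in> space M. exp (- \<tau>) * (\<Prod>i\<in>I. p (X i \<omega>)) \<le> (\<Prod>i\<in>I. p' (X i \<omega>))}
    \<le> exp (\<tau> / 2 - hellinger * card I)"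
proof -
  have fin: "finite I" using I by (rule finite_subset) simp
  have [measurable]: "X i \<in> borel_measurable M" if "i \<in> I" for i
    using I that X_meas by auto
  \<comment> \<open>Values in \<open>ennreal\<close> spare any integrability argument; where
    \<open>p\<close> vanishes, division by zero makes \<open>Y\<close> equal to 0.\<close>
  define Y where "Y i \<omega> = ennreal (sqrt (p' (X i \<omega>) / p (X i \<omega>)))" for i \<omega>
  have Y_meas [measurable]: "Y i \<in> borel_measurable M" if "i \<in> I" for i
    using that unfolding Y_def by measurable
  have "indep_vars (\<lambda>_. borel) (\<lambda>i \<omega>. (\<lambda>x. ennreal (sqrt (p' x / p x))) (X i \<omega>)) I"
    by (rule indep_vars_compose2[OF indep_vars_subset[OF indep I]]) measurable
  then have ind: "indep_vars (\<lambda>_. borel) Y I" by (simp add: Y_def[abs_def])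
  have EY: "(\<integral>\<^sup>+\<omega>. Y i \<omega> \<partial>M) \<le> ennreal affinity" if i: "i \<in> I" for i
  proof -
    have "(\<integral>\<^sup>+\<omega>. Y i \<omega> \<partial>M) = (\<integral>\<^sup>+x. ennreal (sqrt (p' x / p x)) \<partial>distr M borel (X i))"
      using i unfolding Y_def by (subst nn_integral_distr) auto
    also have "\<dots> = (\<integral>\<^sup>+x. ennreal (p x) * ennreal (sqrt (p' x / p x)) \<partial>\<mu>)"
      unfolding distr[OF i] by (subst nn_integral_density) auto
    also have "\<dots> \<le> (\<integral>\<^sup>+x. ennreal (sqrt (p x * p' x)) \<partial>\<mu>)"
    proof (intro nn_integral_mono)
      fix x
      have "p x * sqrt (p' x / p x) \<le> sqrt (p x * p' x)"
      proof (cases "p x = 0")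
        case False
        have "p x * sqrt (p' x / p x) = sqrt ((p x)\<^sup>2 * (p' x / p x))"
          using p[of x] by (simp only: real_sqrt_mult real_sqrt_abs abs_of_nonneg)
        also have "(p x)\<^sup>2 * (p' x / p x) = p x * p' x"
          using False by (simp add: power2_eq_square)
        finally show ?thesis by simp
      qed simp
      then show "ennreal (p x) * ennreal (sqrt (p' x / p x)) \<le> ennreal (sqrt (p x * p' x))"
        using p[of x] by (subst ennreal_mult'[symmetric]) (auto intro: ennreal_leI)
    qed
    finally show ?thesis using aff by simp
  qed
  let ?E = "{\<omega> \<in> space M. exp (- \<tau>) * (\<Prod>i\<in>I. p (X i \<omega>)) \<le> (\<Prod>i\<in>I. p' (X i \<omega>))}"
  let ?u = "\<lambda>\<omega>. \<Prod>i\<in>I. Y i \<omega>"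
  have "AE \<omega> in M. \<forall>i\<in>I. 0 < p (X i \<omega>)"
    using I distr p by (intro AE_all_pos[where p = p]) auto
  \<comment> \<open>The inclusion holds up to a null set only, since it divides by the product of
    \<open>p\<close>. Taking roots turns \<open>\<tau>\<close> into
    \<open>\<tau> / 2\<close>.\<close>
  then have "AE \<omega> in M. \<omega> \<in> ?E \<longrightarrow> \<omega> \<in> {\<omega> \<in> space M. 1 \<le> ennreal (exp (\<tau> / 2)) * ?u \<omega>}"
  proof eventually_elim
    case (elim \<omega>)
    show ?case
    proof
      assume \<omega>: "\<omega> \<in> ?E"
      have P: "0 < (\<Prod>i\<in>I. p (X i \<omega>))" using elim by (intro prod_pos) auto
      then have "exp (- \<tau>) \<le> (\<Prod>i\<in>I. p' (X i \<omega>)) / (\<Prod>i\<in>I. p (X i \<omega>))"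
        using \<omega> by (simp add: field_simps)
      then have "sqrt (exp (- \<tau>)) \<le> sqrt (\<Prod>i\<in>I. p' (X i \<omega>) / p (X i \<omega>))"
        by (simp add: prod_dividef)
      also have "\<dots> = (\<Prod>i\<in>I. sqrt (p' (X i \<omega>) / p (X i \<omega>)))"
        using fin by (induction I rule: finite_induct) (simp_all add: real_sqrt_mult real_sqrt_divide)
      also have "sqrt (exp (- \<tau>)) = exp (- \<tau> / 2)"
        by (rule real_sqrt_unique) (simp_all add: power2_eq_square exp_add[symmetric])
      finally have "exp (- \<tau> / 2) \<le> (\<Prod>i\<in>I. sqrt (p' (X i \<omega>) / p (X i \<omega>)))" .
      then have "exp (\<tau> / 2) * exp (- \<tau> / 2) \<le> exp (\<tau> / 2) * (\<Prod>i\<in>I. sqrt (p' (X i \<omega>) / p (X i \<omega>)))"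
        by (intro mult_left_mono) auto
      then have "1 \<le> ennreal (exp (\<tau> / 2) * (\<Prod>i\<in>I. sqrt (p' (X i \<omega>) / p (X i \<omega>))))"
        by (simp add: exp_add[symmetric])
      also have "\<dots> = ennreal (exp (\<tau> / 2)) * ?u \<omega>"
        unfolding Y_def using p p' by (simp add: ennreal_mult prod_ennreal prod_nonneg)
      finally show "\<omega> \<in> {\<omega> \<in> space M. 1 \<le> ennreal (exp (\<tau> / 2)) * ?u \<omega>}"
        using \<omega> by simp
    qed
  qed
  then have "emeasure M ?E \<le> emeasure M {\<omega> \<in> space M. 1 \<le> ennreal (exp (\<tau> / 2)) * ?u \<omega>}"
    by (intro emeasure_mono_AE) auto
  also have "\<dots> \<le> ennreal (exp (\<tau> / 2)) * (\<integral>\<^sup>+\<omega>. ?u \<omega> * indicator (space M) \<omega> \<partial>M)"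
    by (intro nn_integral_Markov_inequality) auto
  also have "(\<integral>\<^sup>+\<omega>. ?u \<omega> * indicator (space M) \<omega> \<partial>M) = (\<integral>\<^sup>+\<omega>. ?u \<omega> \<partial>M)"
    by (intro nn_integral_cong) auto
  \<comment> \<open>Independence: each observation contributes at most one factor
    \<open>affinity\<close>.\<close>
  also have "\<dots> = (\<Prod>i\<in>I. \<integral>\<^sup>+\<omega>. Y i \<omega> \<partial>M)"
    using fin ind by (intro indep_vars_nn_integral) auto
  also have "\<dots> \<le> (\<Prod>i\<in>I. ennreal affinity)"
    using EY by (intro prod_mono_ennreal) auto
  also have "\<dots> \<le> ennreal (exp (- hellinger) ^ card I)"
    using affinity_nonneg affinity_le_exp
    by (auto simp: ennreal_power intro!: ennreal_leI power_mono)
  also have "ennreal (exp (\<tau> / 2)) * ennreal (exp (- hellinger) ^ card I) =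
      ennreal (exp (\<tau> / 2 - hellinger * card I))"
    by (simp add: ennreal_mult[symmetric] exp_of_nat_mult[symmetric] exp_add[symmetric] mult.commute)
  finally show ?thesis
    by (simp add: emeasure_eq_measure mult_left_mono)
qed

section \<open>Likelihoods by side of and distance from the change point\<close>

text \<open>Candidates are parametrised by their distance from \<^term>\<open>kstar\<close>, separately on each side.\<close>
definition cand :: "bool \<Rightarrow> nat \<Rightarrow> nat" where
  "cand s d = (if s then kstar + d else kstar - d)"

definition reach :: "bool \<Rightarrow> nat" where
  "reach s = (if s then n - kstar else kstar - 1)"

lemma cand_range: "d \<le> reach s \<Longrightarrow> cand s d \<in> {1..n}"
  using kstar by (auto simp: cand_def reach_def split: if_splits)

lemma cand_inj: "inj_on (cand s) {..reach s}"
  using kstar by (auto simp: cand_def reach_def inj_on_def split: if_splits)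

lemma cand_0: "cand s 0 = kstar"
  by (simp add: cand_def)

abbreviation L :: "(nat \<Rightarrow> real) \<Rightarrow> nat \<Rightarrow> real" where
  "L \<equiv> lik p0 p1 n"

lemma L_nonneg: "0 \<le> L x k"
  unfolding lik_def using nonneg by (intro mult_nonneg_nonneg prod_nonneg) auto

lemma L_meas [measurable]: "k \<in> {1..n} \<Longrightarrow> (\<lambda>\<omega>. L (\<lambda>i. X i \<omega>) k) \<in> borel_measurable M"
  unfolding lik_def
  by (intro borel_measurable_times borel_measurable_prod measurable_compose[OF X_meas]) auto

text \<open>After cancelling the common factor, only the \<open>d - r\<close> observations between
  the candidates remain, and \<open>prod_ratio_tail\<close> applies to them. Positivity of the far
  likelihood makes the common factor positive and excludes outcomes where the comparison reads
  \<open>0 \<le> 0\<close>.\<close>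

lemma lik_ratio_tail:
  assumes rd: "r \<le> d" "d \<le> reach s"
  shows "prob {\<omega> \<in> space M. exp (- \<tau>) * L (\<lambda>i. X i \<omega>) (cand s r) \<le> L (\<lambda>i. X i \<omega>) (cand s d) \<and>
      0 < L (\<lambda>i. X i \<omega>) (cand s d)} \<le> exp (\<tau> / 2 - hellinger * real (d - r))" (is "prob ?R \<le> _")
proof -
  have pos: "0 < a" if "0 < a * b" "0 \<le> b" for a b :: real
    using that by (auto simp: zero_less_mult_iff)
  show ?thesis
  proof (cases s)
    case True
    let ?I = "{kstar + r..<kstar + d}"
    let ?E = "{\<omega> \<in> space M. exp (- \<tau>) * (\<Prod>i\<in>?I. p1 (X i \<omega>)) \<le> (\<Prod>i\<in>?I. p0 (X i \<omega>))}"
    have I: "?I \<subseteq> {1..n}" "?I \<subseteq> {kstar..n}" using True rd kstar by (auto simp: reach_def)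
    have "?R \<subseteq> ?E"
    proof
      fix \<omega> assume \<omega>: "\<omega> \<in> ?R"
      define a where "a = (\<Prod>i=1..<kstar + r. p0 (X i \<omega>)) * (\<Prod>i=kstar + d..n. p1 (X i \<omega>))"
      have eq: "L (\<lambda>i. X i \<omega>) (cand s r) = a * (\<Prod>i\<in>?I. p1 (X i \<omega>))"
        "L (\<lambda>i. X i \<omega>) (cand s d) = a * (\<Prod>i\<in>?I. p0 (X i \<omega>))"
        using lik_shift[of "kstar + r" "kstar + d" n p0 p1 "\<lambda>i. X i \<omega>"] True rd kstar by (auto simp: a_def cand_def reach_def)
      have "0 < a"
        using \<omega> nonneg by (intro pos[of a "\<Prod>i\<in>?I. p0 (X i \<omega>)"]) (auto simp: eq intro: prod_nonneg)
      then show "\<omega> \<in> ?E" using \<omega> by (simp add: eq mult.left_commute)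
    qed
    moreover have "?E \<in> sets M"
      using I by (intro sets_prod_le) auto
    ultimately have "prob ?R \<le> prob ?E" by (intro finite_measure_mono)
    also have "\<dots> \<le> exp (\<tau> / 2 - hellinger * card ?I)"
      using I nonneg nn_integral_affinity distr_after
      by (intro prod_ratio_tail) (auto simp: mult.commute)
    finally show ?thesis by simp
  next
    case False
    \<comment> \<open>To the left of the change point the roles are swapped: the observations follow
      \<open>p0\<close>, and the farther candidate rates them by \<open>p1\<close>.\<close>
    let ?I = "{kstar - d..<kstar - r}"
    let ?E = "{\<omega> \<in> space M. exp (- \<tau>) * (\<Prod>i\<in>?I. p0 (X i \<omega>)) \<le> (\<Prod>i\<in>?I. p1 (X i \<omega>))}"
    have I: "?I \<subseteq> {1..n}" "?I \<subseteq> {1..<kstar}" using False rd kstar by (auto simp: reach_def)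
    have "?R \<subseteq> ?E"
    proof
      fix \<omega> assume \<omega>: "\<omega> \<in> ?R"
      define a where "a = (\<Prod>i=1..<kstar - d. p0 (X i \<omega>)) * (\<Prod>i=kstar - r..n. p1 (X i \<omega>))"
      have eq: "L (\<lambda>i. X i \<omega>) (cand s r) = a * (\<Prod>i\<in>?I. p0 (X i \<omega>))"
        "L (\<lambda>i. X i \<omega>) (cand s d) = a * (\<Prod>i\<in>?I. p1 (X i \<omega>))"
        using lik_shift[of "kstar - d" "kstar - r" n p0 p1 "\<lambda>i. X i \<omega>"] False rd kstar by (auto simp: a_def cand_def reach_def)
      have "0 < a"
        using \<omega> nonneg by (intro pos[of a "\<Prod>i\<in>?I. p1 (X i \<omega>)"]) (auto simp: eq intro: prod_nonneg)
      then show "\<omega> \<in> ?E" using \<omega> by (simp add: eq mult.left_commute)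
    qed
    moreover have "?E \<in> sets M"
      using I by (intro sets_prod_le) auto
    ultimately have "prob ?R \<le> prob ?E" by (intro finite_measure_mono)
    also have "\<dots> \<le> exp (\<tau> / 2 - hellinger * card ?I)"
      using I nonneg nn_integral_affinity distr_before
      by (intro prod_ratio_tail) auto
    also have "real (card ?I) = real (d - r)"
      using False rd kstar by (simp add: reach_def)
    finally show ?thesis .
  qed
qed

lemma AE_lik_kstar_pos: "AE \<omega> in M. 0 < L (\<lambda>i. X i \<omega>) kstar"
proof -
  have "AE \<omega> in M. \<forall>i\<in>{1..<kstar}. 0 < p0 (X i \<omega>)"
    using kstar nonneg distr_before by (intro AE_all_pos[where p = p0]) auto
  moreover have "AE \<omega> in M. \<forall>i\<in>{kstar..n}. 0 < p1 (X i \<omega>)"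
    using kstar nonneg distr_after by (intro AE_all_pos[where p = p1]) auto
  ultimately show ?thesis
    by eventually_elim (auto simp: lik_def intro!: mult_pos_pos prod_pos)
qed

definition far_pts :: "real \<Rightarrow> bool \<Rightarrow> nat set" where
  "far_pts \<alpha> s = {d. d \<le> reach s \<and> \<alpha> \<le> real d}"

lemma finite_far_pts [simp]: "finite (far_pts \<alpha> s)"
  by (simp add: far_pts_def)

lemma far_cases:
  assumes k: "k \<in> {1..n}" and far: "\<alpha> \<le> \<bar>real k - real kstar\<bar>"
  obtains s d where "d \<in> far_pts \<alpha> s" "k = cand s d"
proof (cases "kstar \<le> k")
  case True
  show ?thesis
    by (rule that[of "k - kstar" True]) (use True k far in \<open>auto simp: far_pts_def cand_def reach_def\<close>)
next
  case False
  show ?thesis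
    by (rule that[of "kstar - k" False]) (use False k far in \<open>auto simp: far_pts_def cand_def reach_def\<close>)
qed

text \<open>Replaces the extended-real comparison by one of real weighted likelihoods. The positive
  likelihood that this requires is that of \<open>kstar\<close>, available almost surely by
  \<open>AE_lik_kstar_pos\<close>.\<close>

lemma noisy_argmax_lik:
  assumes "0 < L x kstar" "k \<in> noisy_argmax p0 p1 n x z"
  shows "k \<in> {1..n}" "j \<in> {1..n} \<Longrightarrow> L x j * exp (z j) \<le> L x k * exp (z k)"
proof -
  have "kstar \<in> {1..n}" using kstar by simp
  then have "noisy_argmax p0 p1 n x z =
      {k \<in> {1..n}. \<forall>j\<in>{1..n}. L x j * exp (z j) \<le> L x k * exp (z k)}"
    using assms(1) nonneg by (intro noisy_argmax_eq_lik) auto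
  then show "k \<in> {1..n}" "j \<in> {1..n} \<Longrightarrow> L x j * exp (z j) \<le> L x k * exp (z k)"
    using assms(2) by auto
qed

section \<open>Deviation of the maximum likelihood estimator\<close>

text \<open>A far estimate has a positive likelihood that is no smaller than the one at
  \<open>kstar\<close>. The union bound over the distances gives
  \<open>2 / hellinger * exp (- hellinger * \<alpha>)\<close> for each side.\<close>

lemma MLE_far:
  assumes hellinger: "0 < hellinger" and mle: "is_MLE M p0 p1 n X khat"
  shows "prob {\<omega> \<in> space M. \<alpha> \<le> \<bar>real (khat \<omega>) - real kstar\<bar>} \<le> 4 / hellinger * exp (- hellinger * \<alpha>)"
proof -
  define R where "R s d = {\<omega> \<in> space M. L (\<lambda>i. X i \<omega>) kstar \<le> L (\<lambda>i. X i \<omega>) (cand s d) \<and>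
      0 < L (\<lambda>i. X i \<omega>) (cand s d)}" for s d
  have R_sets: "R s d \<in> sets M" if "d \<in> far_pts \<alpha> s" for s d
  proof -
    have "kstar \<in> {1..n}" "cand s d \<in> {1..n}" using kstar that cand_range by (auto simp: far_pts_def)
    note [measurable] = this[THEN L_meas]
    show ?thesis unfolding R_def by measurable
  qed
  have R_le: "prob (R s d) \<le> exp (- hellinger * d)" if "d \<in> far_pts \<alpha> s" for s d
    using lik_ratio_tail[OF le0, of d s 0] that by (simp add: R_def cand_0 far_pts_def)
  let ?F = "{\<omega> \<in> space M. \<alpha> \<le> \<bar>real (khat \<omega>) - real kstar\<bar>}"
  let ?U = "\<lambda>s. \<Union>d\<in>far_pts \<alpha> s. R s d"
  have "AE \<omega> in M. khat \<omega> \<in> noisy_argmax p0 p1 n (\<lambda>i. X i \<omega>) (\<lambda>_. 0)"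
    using mle by (simp add: is_MLE_def)
  then have AE: "AE \<omega> in M. \<omega> \<in> ?F \<longrightarrow> \<omega> \<in> (\<Union>s\<in>UNIV. ?U s)"
    using AE_lik_kstar_pos
  proof eventually_elim
    case (elim \<omega>)
    show ?case
    proof
      assume \<omega>: "\<omega> \<in> ?F"
      have k: "khat \<omega> \<in> {1..n}" "L (\<lambda>i. X i \<omega>) kstar \<le> L (\<lambda>i. X i \<omega>) (khat \<omega>)"
        using noisy_argmax_lik[OF elim(2,1)] kstar by fastforce+
      then obtain s d where "d \<in> far_pts \<alpha> s" "khat \<omega> = cand s d"
        using far_cases[OF k(1), of \<alpha>] \<omega> by blast
      then have "\<omega> \<in> ?U s"
        using k elim \<omega> by (auto simp: R_def)
      then show "\<omega> \<in> (\<Union>s\<in>UNIV. ?U s)" by blast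
    qed
  qed
  have U_sets: "?U s \<in> sets M" for s
    using R_sets by (intro sets.finite_UN) auto
  have "prob ?F \<le> prob (\<Union>s\<in>UNIV. ?U s)"
    using AE U_sets by (intro finite_measure_mono_AE) auto
  also have "\<dots> \<le> (\<Sum>s\<in>UNIV. prob (?U s))"
    using U_sets by (intro finite_measure_subadditive_finite) auto
  also have "\<dots> \<le> (\<Sum>s\<in>(UNIV :: bool set). 2 / hellinger * exp (- hellinger * \<alpha>))"
  proof (rule sum_mono)
    fix s
    have "prob (?U s) \<le> (\<Sum>d\<in>far_pts \<alpha> s. prob (R s d))"
      using R_sets by (intro finite_measure_subadditive_finite) auto
    also have "\<dots> \<le> (\<Sum>d\<in>far_pts \<alpha> s. exp (- hellinger * d))"
      using R_le by (intro sum_mono) auto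
    also have "\<dots> \<le> 2 / hellinger * exp (- hellinger * \<alpha>)"
      using hellinger hellinger_bounds by (intro sum_exp_tail_le) (auto simp: far_pts_def)
    finally show "prob (?U s) \<le> 2 / hellinger * exp (- hellinger * \<alpha>)" .
  qed
  also have "\<dots> = 4 / hellinger * exp (- hellinger * \<alpha>)" by simp
  finally show ?thesis .
qed

section \<open>Deviation of the noisy estimator\<close>

text \<open>The two summands separate data and noise. The first bounds the probability that some far
  likelihood is not smaller than its near partner by the factor
  \<open>exp (- \<gamma> * (d div w))\<close>. The second bounds, for any other data, the
  probability that the noise makes a far candidate win.\<close>

lemma noisy_far:
  fixes Z :: "nat \<Rightarrow> 'a \<Rightarrow> real" and b \<alpha> :: real
  assumes hellinger: "0 < hellinger" and b: "0 < b" and w: "0 < w" "real w \<le> \<alpha>"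
    and Z: "indep_vars (\<lambda>_. borel) Z {1..n}"
    and Z_distr: "\<And>k. k \<in> {1..n} \<Longrightarrow> distr M borel (Z k) = Lap b"
    and XZ: "indep_var (PiM {1..n} (\<lambda>_. borel)) (\<lambda>\<omega>. \<lambda>i\<in>{1..n}. X i \<omega>)
      (PiM {1..n} (\<lambda>_. borel)) (\<lambda>\<omega>. \<lambda>i\<in>{1..n}. Z i \<omega>)"
    and ktil: "AE \<omega> in M. ktil \<omega> \<in> noisy_argmax p0 p1 n (\<lambda>i. X i \<omega>) (\<lambda>k. Z k \<omega>)"
  defines "\<gamma> \<equiv> 7 / 4 * hellinger * w"
  shows "prob {\<omega> \<in> space M. \<alpha> \<le> \<bar>real (ktil \<omega>) - real kstar\<bar>} \<le>
    64 / hellinger * exp (- hellinger / 16 * \<alpha>) + 8 * (exp (- \<gamma> / (2 * b)) / (1 - exp (- \<gamma> / (2 * b))))"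
proof -
  let ?S = "Pi\<^sub>M {1..n} (\<lambda>_. borel :: real measure)"
  let ?PZ = "Pi\<^sub>M {1..n} (\<lambda>_. Lap b)"
  define XR where "XR \<omega> = (\<lambda>i\<in>{1..n}. X i \<omega>)" for \<omega>
  define ZR where "ZR \<omega> = (\<lambda>i\<in>{1..n}. Z i \<omega>)" for \<omega>
  define q where "q = exp (- \<gamma> / (2 * b))"
  have \<gamma>: "0 < \<gamma>" using hellinger w by (simp add: \<gamma>_def)
  then have q: "0 < q" "q < 1" using b by (auto simp: q_def)
  interpret Lb: prob_space "Lap b" using b by (rule prob_space_Lap)
  interpret PZ: prob_space ?PZ by (intro prob_space_PiM) unfold_locales
  have ne: "{1..n} \<noteq> {}" "kstar \<in> {1..n}" using kstar by auto
  have Z_meas: "Z i \<in> borel_measurable M" if "i \<in> {1..n}" for i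
    using Z that by (auto simp: indep_vars_def)
  have XR_meas [measurable]: "XR \<in> M \<rightarrow>\<^sub>M ?S" and ZR_meas [measurable]: "ZR \<in> M \<rightarrow>\<^sub>M ?S"
    using X_meas Z_meas by (auto simp: XR_def[abs_def] ZR_def[abs_def] intro!: measurable_restrict)
  have distr_Z: "distr M ?S ZR = ?PZ"
  proof -
    have "distr M ?S ZR = Pi\<^sub>M {1..n} (\<lambda>i. distr M borel (Z i))"
      using indep_vars_iff_distr_eq_PiM'[where I = "{1..n}" and M' = "\<lambda>_. borel" and X = Z] ne Z Z_meas
      unfolding ZR_def[abs_def] by blast
    also have "\<dots> = ?PZ"
      using Z_distr by (intro PiM_cong) auto
    finally show ?thesis .
  qed
  \<comment> \<open>Independence of data and noise gives a product law, so that the data can be held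
    fixed while the noise is integrated.\<close>
  have joint: "distr M (?S \<Otimes>\<^sub>M ?S) (\<lambda>\<omega>. (XR \<omega>, ZR \<omega>)) = distr M ?S XR \<Otimes>\<^sub>M ?PZ"
  proof -
    have "distr M ?S XR \<Otimes>\<^sub>M distr M ?S ZR = distr M (?S \<Otimes>\<^sub>M ?S) (\<lambda>\<omega>. (XR \<omega>, ZR \<omega>))"
      using XZ unfolding indep_var_distribution_eq XR_def[abs_def] ZR_def[abs_def] by blast
    then show ?thesis by (simp only: distr_Z)
  qed
  interpret PX: prob_space "distr M ?S XR" by (rule prob_space_distr) (rule XR_meas)

  \<comment> \<open>\<open>W\<close> is the event that a far candidate wins, as a set of pairs of
    data and noise; \<open>B\<close> collects the data without the required likelihood gap.\<close>
  define W where "W = {(x, z) \<in> space (?S \<Otimes>\<^sub>M ?S). 0 < L x kstar \<and>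
    (\<exists>s. \<exists>d\<in>far_pts \<alpha> s. \<forall>i\<in>{1..n}. L x i * exp (z i) \<le> L x (cand s d) * exp (z (cand s d)))}"
  define B where "B = (\<Union>s\<in>UNIV. \<Union>d\<in>far_pts \<alpha> s. {x \<in> space ?S.
    exp (- \<gamma> * (d div w)) * L x (cand s (d mod w)) \<le> L x (cand s d) \<and> 0 < L x (cand s d)})"
  have pts: "d \<le> reach s" "w \<le> d" "d mod w \<le> d" "cand s d \<in> {1..n}" "cand s (d mod w) \<in> {1..n}"
    if "d \<in> far_pts \<alpha> s" for s d
  proof -
    show "d \<le> reach s" "w \<le> d" "d mod w \<le> d"
      using that w by (auto simp: far_pts_def)
    moreover from this have "d mod w \<le> reach s" by linarith
    ultimately show "cand s d \<in> {1..n}" "cand s (d mod w) \<in> {1..n}"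
      using cand_range by auto
  qed
  have comp: "(\<lambda>x. x i) \<in> borel_measurable ?S" if "i \<in> {1..n}" for i
    using measurable_component_singleton[OF that, of "\<lambda>_. borel"] by simp
  have L_S: "(\<lambda>x. L x k) \<in> borel_measurable ?S" if "k \<in> {1..n}" for k
    unfolding lik_def
    by (intro borel_measurable_times borel_measurable_prod
      measurable_compose[OF comp meas(1)] measurable_compose[OF comp meas(2)]) (use that in auto)
  have B_sets: "B \<in> sets ?S"
    unfolding B_def
  proof (intro sets.finite_UN finite finite_far_pts)
    fix s d assume d: "d \<in> far_pts \<alpha> s"
    have "{x \<in> space ?S. t * L x i \<le> L x k \<and> 0 < L x k} \<in> sets ?S"
      if i: "i \<in> {1..n}" and k: "k \<in> {1..n}" for t i k
      by (intro sets.sets_Collect_conj borel_measurable_le borel_measurable_less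
        borel_measurable_times borel_measurable_const L_S i k)
    from this[OF pts(5)[OF d] pts(4)[OF d]]
    show "{x \<in> space ?S. exp (- \<gamma> * (d div w)) * L x (cand s (d mod w)) \<le> L x (cand s d) \<and> 0 < L x (cand s d)} \<in> sets ?S" .
  qed
  have W_sets: "W \<in> sets (?S \<Otimes>\<^sub>M ?S)"
  proof -
    have win: "{p \<in> space (?S \<Otimes>\<^sub>M ?S). L (fst p) i * exp (snd p i) \<le> L (fst p) k * exp (snd p k)}
        \<in> sets (?S \<Otimes>\<^sub>M ?S)" if i: "i \<in> {1..n}" and k: "k \<in> {1..n}" for i k
    proof -
      note [measurable] = L_S[OF i] L_S[OF k] comp[OF i] comp[OF k]
      show ?thesis by measurable
    qed
    have pos: "{p \<in> space (?S \<Otimes>\<^sub>M ?S). 0 < L (fst p) kstar} \<in> sets (?S \<Otimes>\<^sub>M ?S)"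
    proof -
      note [measurable] = L_S[OF ne(2)]
      show ?thesis by measurable
    qed
    have "{p \<in> space (?S \<Otimes>\<^sub>M ?S). \<exists>s\<in>UNIV. \<exists>d\<in>far_pts \<alpha> s. \<forall>i\<in>{1..n}.
        L (fst p) i * exp (snd p i) \<le> L (fst p) (cand s d) * exp (snd p (cand s d))}
        \<in> sets (?S \<Otimes>\<^sub>M ?S)" (is "?E \<in> _")
      by (intro sets.sets_Collect_finite_Ex sets.sets_Collect_finite_All win finite finite_far_pts
        finite_atLeastAtMost pts(4))
    moreover have "W = {p \<in> space (?S \<Otimes>\<^sub>M ?S). 0 < L (fst p) kstar} \<inter> ?E"
      by (auto simp: W_def) blast+
    ultimately show ?thesis using pos by (simp only: sets.Int)
  qed
  have L_XR: "L (XR \<omega>) k = L (\<lambda>i. X i \<omega>) k" if "k \<in> {1..n}" for \<omega> k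
    unfolding lik_def XR_def using that by (intro arg_cong2[where f = "(*)"] prod.cong) auto

  have "emeasure M {\<omega> \<in> space M. \<alpha> \<le> \<bar>real (ktil \<omega>) - real kstar\<bar>} \<le>
      emeasure M ((\<lambda>\<omega>. (XR \<omega>, ZR \<omega>)) -` W \<inter> space M)"
  proof (rule emeasure_mono_AE)
    show "AE \<omega> in M. \<omega> \<in> {\<omega> \<in> space M. \<alpha> \<le> \<bar>real (ktil \<omega>) - real kstar\<bar>} \<longrightarrow>
        \<omega> \<in> (\<lambda>\<omega>. (XR \<omega>, ZR \<omega>)) -` W \<inter> space M"
      using ktil AE_lik_kstar_pos
    proof eventually_elim
      case (elim \<omega>)
      show ?case
      proof
        assume \<omega>: "\<omega> \<in> {\<omega> \<in> space M. \<alpha> \<le> \<bar>real (ktil \<omega>) - real kstar\<bar>}"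
        have k: "ktil \<omega> \<in> {1..n}"
          and win: "\<And>j. j \<in> {1..n} \<Longrightarrow> L (\<lambda>i. X i \<omega>) j * exp (Z j \<omega>) \<le>
            L (\<lambda>i. X i \<omega>) (ktil \<omega>) * exp (Z (ktil \<omega>) \<omega>)"
          using noisy_argmax_lik[OF elim(2,1)] by auto
        obtain s d where d: "d \<in> far_pts \<alpha> s" "ktil \<omega> = cand s d"
          using far_cases[OF k, of \<alpha>] \<omega> by blast
        have "\<forall>i\<in>{1..n}. L (XR \<omega>) i * exp (ZR \<omega> i) \<le> L (XR \<omega>) (cand s d) * exp (ZR \<omega> (cand s d))"
          using k win L_XR unfolding d(2)[symmetric] by (auto simp: ZR_def)
        moreover have "(XR \<omega>, ZR \<omega>) \<in> space (?S \<Otimes>\<^sub>M ?S)"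
          using \<omega> measurable_space[OF XR_meas, of \<omega>] measurable_space[OF ZR_meas, of \<omega>]
          by (auto simp: space_pair_measure)
        ultimately show "\<omega> \<in> (\<lambda>\<omega>. (XR \<omega>, ZR \<omega>)) -` W \<inter> space M"
          using \<omega> elim(2) L_XR[OF ne(2)] d(1) by (auto simp: W_def)
      qed
    qed
  qed (use W_sets in measurable)
  also have "\<dots> = emeasure (distr M ?S XR \<Otimes>\<^sub>M ?PZ) W"
    unfolding joint[symmetric] using W_sets by (intro emeasure_distr[symmetric]) measurable
  also have "\<dots> = (\<integral>\<^sup>+x. emeasure ?PZ (Pair x -` W) \<partial>distr M ?S XR)"
  proof (rule PZ.emeasure_pair_measure_alt)
    have "sets (?S \<Otimes>\<^sub>M ?S) = sets (distr M ?S XR \<Otimes>\<^sub>M ?PZ)"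
      by (intro sets_pair_measure_cong sets_PiM_cong) auto
    then show "W \<in> sets (distr M ?S XR \<Otimes>\<^sub>M ?PZ)" using W_sets by simp
  qed
  \<comment> \<open>For data in \<open>B\<close> the noise probability is bounded by 1; otherwise
    \<open>Lap_argmax_far\<close> gives \<open>4 * (q / (1 - q))\<close> for each side. Data with
    \<open>L x kstar = 0\<close> have an empty section in \<open>W\<close>.\<close>
  also have "\<dots> \<le> (\<integral>\<^sup>+x. indicator B x + ennreal (8 * (q / (1 - q))) \<partial>distr M ?S XR)"
  proof (rule nn_integral_mono)
    fix x assume x: "x \<in> space (distr M ?S XR)"
    show "emeasure ?PZ (Pair x -` W) \<le> indicator B x + ennreal (8 * (q / (1 - q)))"
    proof (cases "x \<in> B \<or> \<not> 0 < L x kstar")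
      case True
      then show ?thesis
      proof
        assume "x \<in> B"
        then show ?thesis using PZ.emeasure_le_1[of "Pair x -` W"] by (simp add: add_increasing2)
      next
        assume "\<not> 0 < L x kstar"
        then have "Pair x -` W = {}" by (auto simp: W_def)
        then show ?thesis by simp
      qed
    next
      case False
      define F where "F s = {z \<in> space ?PZ. \<exists>d\<in>far_pts \<alpha> s.
        \<forall>i\<in>{1..n}. L x i * exp (z i) \<le> L x (cand s d) * exp (z (cand s d))}" for s
      have F_sets: "F s \<in> sets ?PZ" for s
      proof -
        have "F s = (\<Union>d\<in>far_pts \<alpha> s. {z \<in> space ?PZ. \<forall>i\<in>{1..n}.
            L x i * exp (z i) \<le> L x (cand s d) * exp (z (cand s d))})"
          by (auto simp: F_def)
        also have "\<dots> \<in> sets ?PZ"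
          by (intro sets.finite_UN sets_argmax finite_far_pts finite_atLeastAtMost pts(4))
        finally show ?thesis .
      qed
      have F_le: "PZ.prob (F s) \<le> 4 * (q / (1 - q))" for s
        unfolding F_def q_def
      proof (rule Lap_argmax_far[where N = "reach s" and w = w])
        show "\<exists>i\<in>{1..n}. 0 < L x i" using False ne by auto
        show "cand s ` {..reach s} \<subseteq> {1..n}" using cand_range by auto
        show "far_pts \<alpha> s \<subseteq> {w..reach s}" using pts by auto
        show "L x (cand s d) \<le> exp (- \<gamma> * (d div w)) * L x (cand s (d mod w))"
          if d: "d \<in> far_pts \<alpha> s" for d
        proof (cases "0 < L x (cand s d)")
          case True
          then show ?thesis using False d x by (force simp: B_def)
        next
          case F: False
          \<comment> \<open>\<open>B\<close> records positive far likelihoods only; for a vanishing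
            one the gap is trivial.\<close>
          then have "L x (cand s d) \<le> 0" by simp
          also have "0 \<le> exp (- \<gamma> * (d div w)) * L x (cand s (d mod w))"
            using L_nonneg by simp
          finally show ?thesis .
        qed
      qed (use b \<gamma> w L_nonneg cand_inj in auto)
      have "emeasure ?PZ (Pair x -` W) \<le> emeasure ?PZ (\<Union>s\<in>UNIV. F s)"
      proof (rule emeasure_mono)
        show "Pair x -` W \<subseteq> (\<Union>s\<in>UNIV. F s)"
          by (auto simp: W_def F_def space_pair_measure space_PiM)
        show "(\<Union>s\<in>UNIV. F s) \<in> sets ?PZ"
          using F_sets by (intro sets.finite_UN) auto
      qed
      also have "\<dots> \<le> ennreal (8 * (q / (1 - q)))"
      proof -
        have "PZ.prob (\<Union>s\<in>UNIV. F s) \<le> (\<Sum>s\<in>UNIV. PZ.prob (F s))"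
          using F_sets by (intro PZ.finite_measure_subadditive_finite) auto
        also have "\<dots> \<le> (\<Sum>s\<in>(UNIV :: bool set). 4 * (q / (1 - q)))"
          by (intro sum_mono F_le)
        also have "\<dots> = 8 * (q / (1 - q))" by simp
        finally show ?thesis by (simp only: PZ.emeasure_eq_measure ennreal_leI)
      qed
      finally show ?thesis by (simp add: add_increasing)
    qed
  qed
  also have "\<dots> = emeasure M (XR -` B \<inter> space M) + ennreal (8 * (q / (1 - q)))"
    using B_sets PX.emeasure_space_1 emeasure_distr[OF XR_meas B_sets] by (simp add: nn_integral_add)
  also have "\<dots> \<le> ennreal (64 / hellinger * exp (- hellinger / 16 * \<alpha>)) + ennreal (8 * (q / (1 - q)))"
  proof (rule add_right_mono)
    define R where "R s d = {\<omega> \<in> space M. exp (- \<gamma> * (d div w)) * L (\<lambda>i. X i \<omega>) (cand s (d mod w)) \<le>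
      L (\<lambda>i. X i \<omega>) (cand s d) \<and> 0 < L (\<lambda>i. X i \<omega>) (cand s d)}" for s d
    have R_sets: "R s d \<in> sets M" if d: "d \<in> far_pts \<alpha> s" for s d
    proof -
      note [measurable] = L_meas[OF pts(4)[OF d]] L_meas[OF pts(5)[OF d]]
      show ?thesis unfolding R_def by measurable
    qed
    have R_le: "prob (R s d) \<le> exp (- (hellinger / 16) * d)" if d: "d \<in> far_pts \<alpha> s" for s d
    proof -
      have diff: "d - d mod w = w * (d div w)"
        by (metis minus_mod_eq_mult_div)
      have "1 \<le> d div w" using pts(2)[OF d] w by (simp add: div_greater_zero_iff Suc_le_eq)
      then have "w * 1 \<le> w * (d div w)" by (intro mult_left_mono) auto
      \<comment> \<open>The remainder is less than \<open>w\<close>, hence at most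
        \<open>w * (d div w)\<close>: passing to the near partner keeps at least half of the
        distance.\<close>
      then have "d \<le> 2 * (w * (d div w))"
        using mod_less_divisor[OF w(1), of d] mult_div_mod_eq[of w d] by linarith
      then have d2: "real d \<le> 2 * (real w * real (d div w))"
        by (metis of_nat_le_iff of_nat_mult of_nat_numeral)
      have "prob (R s d) \<le> exp (\<gamma> * (d div w) / 2 - hellinger * real (d - d mod w))"
        using lik_ratio_tail[OF pts(3,1)[OF d], of "\<gamma> * (d div w)"] by (simp add: R_def)
      \<comment> \<open>With \<open>\<gamma> = 7/4 * hellinger * w\<close> the exponent is
        \<open>7/8 - 1 = - 1/8\<close> times \<open>hellinger * w * (d div w)\<close>; the previous
        halving turns 1/8 into 1/16.\<close>
      also have "\<gamma> * (d div w) / 2 - hellinger * real (d - d mod w) = - (hellinger / 16) * (2 * (real w * real (d div w)))"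
        by (simp add: diff \<gamma>_def)
      also have "\<dots> \<le> - (hellinger / 16) * d"
        using d2 hellinger by (intro mult_left_mono_neg) auto
      finally show ?thesis by simp
    qed
    have "XR -` B \<inter> space M = (\<Union>s\<in>UNIV. \<Union>d\<in>far_pts \<alpha> s. R s d)"
    proof -
      have "XR \<omega> \<in> space ?S" if "\<omega> \<in> space M" for \<omega>
        using measurable_space[OF XR_meas that] .
      moreover have "L (XR \<omega>) (cand s d) = L (\<lambda>i. X i \<omega>) (cand s d)"
        "L (XR \<omega>) (cand s (d mod w)) = L (\<lambda>i. X i \<omega>) (cand s (d mod w))"
        if "d \<in> far_pts \<alpha> s" for s d \<omega>
        using pts(4,5)[OF that] L_XR by auto
      ultimately show ?thesis by (auto simp: B_def R_def) blast+
    qed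
    also have "prob \<dots> \<le> (\<Sum>s\<in>UNIV. prob (\<Union>d\<in>far_pts \<alpha> s. R s d))"
      using R_sets by (intro finite_measure_subadditive_finite) auto
    also have "\<dots> \<le> (\<Sum>s\<in>(UNIV :: bool set). 2 / (hellinger / 16) * exp (- (hellinger / 16) * \<alpha>))"
    proof (rule sum_mono)
      fix s
      have "prob (\<Union>d\<in>far_pts \<alpha> s. R s d) \<le> (\<Sum>d\<in>far_pts \<alpha> s. prob (R s d))"
        using R_sets by (intro finite_measure_subadditive_finite) auto
      also have "\<dots> \<le> (\<Sum>d\<in>far_pts \<alpha> s. exp (- (hellinger / 16) * d))"
        using R_le by (intro sum_mono) auto
      also have "\<dots> \<le> 2 / (hellinger / 16) * exp (- (hellinger / 16) * \<alpha>)"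
        using hellinger hellinger_bounds by (intro sum_exp_tail_le) (auto simp: far_pts_def)
      finally show "prob (\<Union>d\<in>far_pts \<alpha> s. R s d) \<le> 2 / (hellinger / 16) * exp (- (hellinger / 16) * \<alpha>)" .
    qed
    also have "\<dots> = 64 / hellinger * exp (- hellinger / 16 * \<alpha>)" by simp
    finally show "emeasure M (XR -` B \<inter> space M) \<le> ennreal (64 / hellinger * exp (- hellinger / 16 * \<alpha>))"
      by (simp add: emeasure_eq_measure ennreal_leI)
  qed
  finally show ?thesis
    unfolding q_def[symmetric] using q hellinger by (simp add: emeasure_eq_measure flip: ennreal_plus)
qed

end

section \<open>Accuracy with explicit constants\<close>

text \<open>Absorbs the prefactor \<open>y = 1 / C_M\<close> of the tail bounds into the
  exponential, at the cost of one unit of \<open>a\<close>.\<close>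

lemma linear_times_exp_le:
  fixes y l a :: real
  assumes y: "2 / 3 \<le> y" and l: "2 \<le> l"
  shows "y * exp (- (a * l * y)) \<le> exp (- ((a - 1) * l * y))"
proof -
  have "y \<le> exp y" using exp_ge_add_one_self[of y] by linarith
  also have "y \<le> l * y" using y l mult_right_mono[of 1 l y] by simp
  finally have "y * exp (- (a * l * y)) \<le> exp (l * y) * exp (- (a * l * y))"
    by (intro mult_right_mono) auto
  also have "\<dots> = exp (- ((a - 1) * l * y))"
    by (simp add: exp_add[symmetric] algebra_simps)
  finally show ?thesis .
qed

lemma ln_ge_2:
  fixes x :: real
  assumes "9 \<le> x"
  shows "2 \<le> ln x"
proof -
  have "exp (2::real) = exp 1 * exp 1" by (simp add: exp_add[symmetric])
  also have "\<dots> \<le> 3 * 3" using exp_le by (intro mult_mono) auto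
  finally show ?thesis using assms by (subst ln_ge_iff) auto
qed

context change_point
begin

lemma accurate_if_far_le:
  assumes [measurable]: "k \<in> M \<rightarrow>\<^sub>M count_space UNIV"
    and le: "prob {\<omega> \<in> space M. \<alpha> \<le> \<bar>real (k \<omega>) - real kstar\<bar>} \<le> \<beta>"
  shows "accurate M kstar \<alpha> \<beta> k"
proof -
  have "{\<omega> \<in> space M. \<bar>real (k \<omega>) - real kstar\<bar> < \<alpha>} =
      space M - {\<omega> \<in> space M. \<alpha> \<le> \<bar>real (k \<omega>) - real kstar\<bar>}" by auto
  moreover have "{\<omega> \<in> space M. \<alpha> \<le> \<bar>real (k \<omega>) - real kstar\<bar>} \<in> sets M" by measurable
  ultimately show ?thesis
    using le by (simp add: accurate_def prob_compl)
qed

lemma accurate_mono: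
  assumes [measurable]: "k \<in> M \<rightarrow>\<^sub>M count_space UNIV"
    and "accurate M kstar \<alpha> \<beta> k" "\<alpha> \<le> \<alpha>'"
  shows "accurate M kstar \<alpha>' \<beta> k"
proof -
  have "prob {\<omega> \<in> space M. \<bar>real (k \<omega>) - real kstar\<bar> < \<alpha>} \<le>
      prob {\<omega> \<in> space M. \<bar>real (k \<omega>) - real kstar\<bar> < \<alpha>'}"
    using assms(3) by (intro finite_measure_mono) auto
  then show ?thesis using assms(2) by (simp add: accurate_def)
qed

lemma accurate_trivial: "1 \<le> \<beta> \<Longrightarrow> accurate M kstar \<alpha> \<beta> k"
  unfolding accurate_def using measure_nonneg[of M] by (smt (verit))

context
  assumes ne: "density \<mu> p0 \<noteq> density \<mu> p1"
begin

text \<open>All four follow from \<open>0 < C_M \<le> 3/2 * hellinger\<close> together with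
  \<open>hellinger \<le> 1\<close>.\<close>

lemma inverse_C_M: "0 < hellinger" "2 / 3 \<le> 1 / C_M \<mu> p0 p1" "1 / hellinger \<le> 3 / 2 * (1 / C_M \<mu> p0 p1)"
  "2 / 3 * C_M \<mu> p0 p1 \<le> hellinger"
proof -
  have C: "0 < C_M \<mu> p0 p1" "C_M \<mu> p0 p1 \<le> 3 / 2 * hellinger"
    using C_M_pos[OF ne] C_M_le_hellinger by auto
  then show h: "0 < hellinger" by simp
  show "2 / 3 * C_M \<mu> p0 p1 \<le> hellinger" using C by simp
  have "C_M \<mu> p0 p1 \<le> 3 / 2" using C hellinger_bounds by linarith
  then show "2 / 3 \<le> 1 / C_M \<mu> p0 p1" using C by (simp add: field_simps)
  show "1 / hellinger \<le> 3 / 2 * (1 / C_M \<mu> p0 p1)" using C h by (simp add: field_simps)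
qed

text \<open>One of the two factors \<open>1 / C_M\<close> in \<open>\<alpha>\<close> is spent on
  \<open>hellinger \<ge> 2/3 * C_M\<close>; the other stays in the exponent and later outweighs the
  prefactor.\<close>

lemma hellinger_times_le:
  assumes "0 \<le> l" "K / (C_M \<mu> p0 p1)\<^sup>2 * l \<le> \<alpha>" "0 \<le> K"
  shows "2 / 3 * K * l * (1 / C_M \<mu> p0 p1) \<le> hellinger * \<alpha>"
proof -
  have C: "0 < C_M \<mu> p0 p1" using C_M_pos[OF ne] .
  have "2 / 3 * K * l * (1 / C_M \<mu> p0 p1) = 2 / 3 * C_M \<mu> p0 p1 * (K / (C_M \<mu> p0 p1)\<^sup>2 * l)"
    using C by (simp add: field_simps power2_eq_square)
  also have "\<dots> \<le> hellinger * \<alpha>"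
    using assms inverse_C_M C by (intro mult_mono) auto
  finally show ?thesis .
qed

lemma MLE_accurate:
  assumes \<beta>: "0 < \<beta>" and mle: "is_MLE M p0 p1 n X khat"
  shows "accurate M kstar (67 / (C_M \<mu> p0 p1)\<^sup>2 * ln (64 / (3 * \<beta>))) \<beta> khat"
proof (cases "1 \<le> \<beta>")
  case True
  then show ?thesis by (rule accurate_trivial)
next
  case False
  define l where "l = ln (64 / (3 * \<beta>))"
  define y where "y = 1 / C_M \<mu> p0 p1"
  define \<alpha> where "\<alpha> = 67 / (C_M \<mu> p0 p1)\<^sup>2 * l"
  have l: "2 \<le> l" unfolding l_def using \<beta> False by (intro ln_ge_2) (simp add: field_simps)
  have y: "2 / 3 \<le> y" "1 / hellinger \<le> 3 / 2 * y" using inverse_C_M by (auto simp: y_def)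
  have ly: "4 / 3 \<le> l * y" using mult_mono[of 2 l "2 / 3" y] l y by simp
  have l_ly: "2 / 3 * l \<le> l * y" using mult_left_mono[OF y(1), of l] l by (simp add: mult.commute)
  have "2 / 3 * 67 * l * y \<le> hellinger * \<alpha>"
    using hellinger_times_le[of l 67 \<alpha>] l by (simp add: \<alpha>_def y_def)
  \<comment> \<open>\<open>2/3 * 67\<close> is about 44.7.\<close>
  then have "44 * l * y \<le> hellinger * \<alpha>"
    using ly by simp
  have "prob {\<omega> \<in> space M. \<alpha> \<le> \<bar>real (khat \<omega>) - real kstar\<bar>} \<le> 4 / hellinger * exp (- hellinger * \<alpha>)"
    using MLE_far[OF inverse_C_M(1) mle] .
  also have "\<dots> \<le> 6 * y * exp (- (44 * l * y))"
    using y \<open>44 * l * y \<le> hellinger * \<alpha>\<close> by (intro mult_mono) auto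
  also have "\<dots> \<le> 6 * exp (- (43 * l * y))"
    using linear_times_exp_le[OF y(1) l, of 44] by simp
  also have "\<dots> \<le> 6 * exp (- l)"
    using l_ly l by simp
  \<comment> \<open>\<open>6 * exp (- l) = 6 * 3 * \<beta> / 64\<close>, which is less than
    \<open>\<beta> / 3\<close>.\<close>
  also have "\<dots> \<le> \<beta>"
    using \<beta> by (simp add: l_def exp_minus)
  finally show ?thesis
    using mle by (intro accurate_if_far_le) (auto simp: is_MLE_def \<alpha>_def l_def)
qed

lemma noisy_accurate:
  assumes \<beta>: "0 < \<beta>" and b: "0 \<le> b"
    and ktil: "ktil \<in> M \<rightarrow>\<^sub>M count_space UNIV"
      "AE \<omega> in M. ktil \<omega> \<in> noisy_argmax p0 p1 n (\<lambda>i. X i \<omega>) (\<lambda>k. Z k \<omega>)"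
    and Z: "indep_vars (\<lambda>_. borel) Z {1..n}"
    and Z_distr: "\<And>k. k \<in> {1..n} \<Longrightarrow> distr M borel (Z k) = Lap b"
    and XZ: "indep_var (PiM {1..n} (\<lambda>_. borel)) (\<lambda>\<omega>. \<lambda>i\<in>{1..n}. X i \<omega>)
      (PiM {1..n} (\<lambda>_. borel)) (\<lambda>\<omega>. \<lambda>i\<in>{1..n}. Z i \<omega>)"
    and \<alpha>: "262 / (C_M \<mu> p0 p1)\<^sup>2 * ln (128 / (3 * \<beta>)) \<le> \<alpha>"
      "2 * b * ln (16 / \<beta>) / C_M \<mu> p0 p1 \<le> \<alpha>"
  shows "accurate M kstar \<alpha> \<beta> ktil"
proof (cases "1 \<le> \<beta>")
  case True
  then show ?thesis by (rule accurate_trivial)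
next
  case \<beta>1: False
  have C: "0 < C_M \<mu> p0 p1" using C_M_pos[OF ne] .
  show ?thesis
  proof (cases "b = 0")
    \<comment> \<open>A vanishing threshold means no noise: the estimator is then almost surely a
      maximum likelihood estimator, whose bound is below the present
      \<open>\<alpha>\<close>.\<close>
    case True
    have "AE \<omega> in M. \<forall>k\<in>{1..n}. Z k \<omega> = 0"
    proof (subst AE_finite_all)
      show "\<forall>k\<in>{1..n}. AE \<omega> in M. Z k \<omega> = 0"
      proof
        fix k assume k: "k \<in> {1..n}"
        have "AE z in return borel 0. z = (0::real)" by (subst AE_return) auto
        then have "AE z in distr M borel (Z k). z = 0"
          using Z_distr[OF k] by (simp only: Lap_def True simp_thms if_True)
        then show "AE \<omega> in M. Z k \<omega> = 0"
          using Z k by (subst (asm) AE_distr_iff) (auto simp: indep_vars_def)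
      qed
    qed simp
    then have "AE \<omega> in M. ktil \<omega> \<in> noisy_argmax p0 p1 n (\<lambda>i. X i \<omega>) (\<lambda>_. 0)"
      using ktil(2) by eventually_elim (auto simp: noisy_argmax_def)
    then have "is_MLE M p0 p1 n X ktil" using ktil(1) by (simp add: is_MLE_def)
    note acc = MLE_accurate[OF \<beta> this]
    have "67 / (C_M \<mu> p0 p1)\<^sup>2 * ln (64 / (3 * \<beta>)) \<le> 262 / (C_M \<mu> p0 p1)\<^sup>2 * ln (128 / (3 * \<beta>))"
      using \<beta> \<beta>1 by (intro mult_mono divide_right_mono) (auto simp: field_simps)
    also note \<alpha>(1)
    finally show ?thesis using accurate_mono[OF ktil(1) acc] by blast
  next
    case False
    then have b: "0 < b" using b by simp
    define l where "l = ln (128 / (3 * \<beta>))"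
    define y where "y = 1 / C_M \<mu> p0 p1"
    have l: "2 \<le> l" unfolding l_def using \<beta> \<beta>1 by (intro ln_ge_2) (simp add: field_simps)
    have y: "2 / 3 \<le> y" "1 / hellinger \<le> 3 / 2 * y" using inverse_C_M by (auto simp: y_def)
    have ly: "4 / 3 \<le> l * y" using mult_mono[of 2 l "2 / 3" y] l y by simp
    have l_ly: "2 / 3 * l \<le> l * y" using mult_left_mono[OF y(1), of l] l by (simp add: mult.commute)
    have hellinger_\<alpha>: "2 / 3 * 262 * l * y \<le> hellinger * \<alpha>"
      using hellinger_times_le[of l 262 \<alpha>] l \<alpha>(1) by (simp add: l_def y_def)
    \<comment> \<open>Much weaker than what is available; \<open>\<alpha> \<ge> 7\<close> ensures
      that rounding down to \<open>w\<close> keeps \<open>w \<ge> 6/7 * \<alpha>\<close>.\<close>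
    then have "7 \<le> hellinger * \<alpha>" using ly by simp
    moreover have "hellinger * \<alpha> \<le> 1 * \<alpha>" if "0 \<le> \<alpha>"
      using hellinger_bounds that by (intro mult_right_mono) auto
    moreover have "0 \<le> \<alpha>"
      using \<open>7 \<le> hellinger * \<alpha>\<close> inverse_C_M(1) by (smt (verit) mult_nonneg_nonpos)
    ultimately have \<alpha>7: "7 \<le> \<alpha>" by simp
    define w where "w = nat \<lfloor>\<alpha>\<rfloor>"
    have w: "real w \<le> \<alpha>" "\<alpha> - 1 \<le> real w"
      using \<alpha>7 by (auto simp: w_def)
    then have w_pos: "0 < w" using \<alpha>7 by (cases "w = 0") auto
    define \<gamma> where "\<gamma> = 7 / 4 * hellinger * w"
    define q where "q = exp (- \<gamma> / (2 * b))"
    have far: "prob {\<omega> \<in> space M. \<alpha> \<le> \<bar>real (ktil \<omega>) - real kstar\<bar>} \<le>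
        64 / hellinger * exp (- hellinger / 16 * \<alpha>) + 8 * (q / (1 - q))"
      unfolding q_def \<gamma>_def
      using noisy_far[OF inverse_C_M(1) b w_pos w(1) Z Z_distr XZ ktil(2)] .
    have "10 * l * y \<le> hellinger / 16 * \<alpha>" using hellinger_\<alpha> ly by simp
    then have "64 / hellinger * exp (- hellinger / 16 * \<alpha>) \<le> 96 * y * exp (- (10 * l * y))"
      using y by (intro mult_mono) auto
    also have "\<dots> \<le> 96 * exp (- (9 * l * y))"
      using linear_times_exp_le[OF y(1) l, of 10] by simp
    \<comment> \<open>\<open>9 * l * y \<ge> 6 * l \<ge> l + 10\<close>; the spare
      \<open>exp (- 10) \<le> 1/11\<close> brings the data part below
      \<open>\<beta> / 4\<close>.\<close>
    also have "\<dots> \<le> 96 * exp (- l + - 10)"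
    proof -
      have "l + 10 \<le> 9 * (l * y)" using l_ly l by linarith
      then show ?thesis by (simp add: mult.assoc)
    qed
    also have "\<dots> = 96 * (3 * \<beta> / 128) * exp (- 10)"
    proof -
      have "exp (- l) = 3 * \<beta> / 128" using \<beta> by (simp add: l_def exp_minus)
      then show ?thesis by (simp only: exp_add mult.assoc)
    qed
    also have "\<dots> \<le> 96 * (3 * \<beta> / 128) * (1 / 11)"
      using \<beta> exp_ge_add_one_self[of "10::real"]
      by (intro mult_left_mono) (auto simp: exp_minus field_simps)
    finally have 1: "64 / hellinger * exp (- hellinger / 16 * \<alpha>) \<le> \<beta> / 4" using \<beta> by simp
    have "2 * b * ln (16 / \<beta>) \<le> C_M \<mu> p0 p1 * \<alpha>"
      using \<alpha>(2) C by (simp add: field_simps)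
    \<comment> \<open>The constants multiply to 1: the factor 7/4 in \<open>\<gamma>\<close>
      compensates exactly for the losses 2/3 in \<open>hellinger \<ge> 2/3 * C_M\<close> and 6/7 in
      \<open>w \<ge> 6/7 * \<alpha>\<close>.\<close>
    also have "\<dots> = 7 / 4 * (2 / 3 * C_M \<mu> p0 p1) * (6 / 7 * \<alpha>)" by simp
    also have "\<dots> \<le> \<gamma>"
      unfolding \<gamma>_def using inverse_C_M(1,4) C w \<alpha>7 by (intro mult_mono) auto
    finally have "ln (16 / \<beta>) \<le> \<gamma> / (2 * b)"
      using b by (simp add: field_simps)
    then have "q \<le> exp (- ln (16 / \<beta>))" by (simp add: q_def)
    also have "\<dots> = \<beta> / 16" using \<beta> by (simp add: exp_minus)
    finally have "q \<le> \<beta> / 16" .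
    \<comment> \<open>The noise part is thus at most \<open>8/15 * \<beta>\<close>, and together
      with \<open>\<beta> / 4\<close> this stays below \<open>\<beta>\<close>.\<close>
    then have "q / (1 - q) \<le> (\<beta> / 16) / (15 / 16)"
      using \<beta>1 \<beta> by (intro frac_le) auto
    then show ?thesis
      using far 1 \<beta> by (intro accurate_if_far_le ktil) auto
  qed
qed

end

end

lemma A_thr_nonneg: "0 \<le> A_thr \<mu> p0 p1 \<delta>"
  unfolding A_thr_def by (rule INF_greatest) auto

theorem theorem7:
  fixes \<mu> :: "real measure" and p0 p1 :: "real \<Rightarrow> real"
    and M :: "'a measure" and X :: "nat \<Rightarrow> 'a \<Rightarrow> real"
    and n kstar :: nat and \<delta> :: real
  assumes "sets \<mu> = sets borel"
    and "p0 \<in> borel_measurable borel" and "p1 \<in> borel_measurable borel"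
    and "\<And>x. 0 \<le> p0 x" and "\<And>x. 0 \<le> p1 x"
    and "prob_space (density \<mu> p0)" and "prob_space (density \<mu> p1)"
    and "density \<mu> p0 \<noteq> density \<mu> p1"
    and "0 < \<delta>" and "A_thr \<mu> p0 p1 \<delta> < \<infinity>"
    and "prob_space M"
    and "1 < kstar" and "kstar < n"
    and "change_point_data M \<mu> p0 p1 n kstar X"
  shows "(\<forall>\<beta>>0. \<forall>khat. is_MLE M p0 p1 n X khat \<longrightarrow>
            accurate M kstar (67 / (C_M \<mu> p0 p1)\<^sup>2 * ln (64 / (3 * \<beta>))) \<beta> khat) \<and>
         (\<forall>\<epsilon>>0. \<forall>\<beta>>0. \<forall>ktil. is_OfflinePCPD M \<mu> p0 p1 \<epsilon> \<delta> n X ktil \<longrightarrow>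
            accurate M kstar
              (max (262 / (C_M \<mu> p0 p1)\<^sup>2 * ln (128 / (3 * \<beta>)))
                   (2 * real_of_ereal (A_thr \<mu> p0 p1 \<delta>) * ln (16 / \<beta>) / (C_M \<mu> p0 p1 * \<epsilon>)))
              \<beta> ktil)"
proof -
  interpret change_point \<mu> p0 p1 M X n kstar
    using assms by (intro change_point.intro density_pair.intro change_point_axioms.intro) auto
  note ne = \<open>density \<mu> p0 \<noteq> density \<mu> p1\<close>
  show ?thesis
  proof (intro conjI allI impI)
    fix \<beta> :: real and khat assume "0 < \<beta>" "is_MLE M p0 p1 n X khat"
    then show "accurate M kstar (67 / (C_M \<mu> p0 p1)\<^sup>2 * ln (64 / (3 * \<beta>))) \<beta> khat"
      using MLE_accurate[OF ne] by blast
  next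
    fix \<epsilon> \<beta> :: real and ktil
    assume \<epsilon>: "0 < \<epsilon>" and \<beta>: "0 < \<beta>" and ktil: "is_OfflinePCPD M \<mu> p0 p1 \<epsilon> \<delta> n X ktil"
    \<comment> \<open>The threshold is nonnegative and, by assumption, finite, so
      \<open>real_of_ereal\<close> returns its actual value and not a default.\<close>
    define b where "b = real_of_ereal (A_thr \<mu> p0 p1 \<delta>) / \<epsilon>"
    have b: "0 \<le> b"
      using \<epsilon> A_thr_nonneg by (auto simp: b_def intro!: divide_nonneg_pos real_of_ereal_pos)
    obtain Z where Z: "indep_vars (\<lambda>_. borel) Z {1..n}"
      "\<And>k. k \<in> {1..n} \<Longrightarrow> distr M borel (Z k) = Lap b"
      "indep_var (PiM {1..n} (\<lambda>_. borel)) (\<lambda>\<omega>. \<lambda>i\<in>{1..n}. X i \<omega>)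
        (PiM {1..n} (\<lambda>_. borel)) (\<lambda>\<omega>. \<lambda>i\<in>{1..n}. Z i \<omega>)"
      "AE \<omega> in M. ktil \<omega> \<in> noisy_argmax p0 p1 n (\<lambda>i. X i \<omega>) (\<lambda>k. Z k \<omega>)"
      and meas_ktil: "ktil \<in> M \<rightarrow>\<^sub>M count_space UNIV"
      using ktil unfolding is_OfflinePCPD_def b_def by blast
    show "accurate M kstar
        (max (262 / (C_M \<mu> p0 p1)\<^sup>2 * ln (128 / (3 * \<beta>)))
             (2 * real_of_ereal (A_thr \<mu> p0 p1 \<delta>) * ln (16 / \<beta>) / (C_M \<mu> p0 p1 * \<epsilon>)))
        \<beta> ktil"
    proof (rule noisy_accurate[OF ne \<beta> b meas_ktil Z(4) Z(1,2,3)])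
      have "2 * b * ln (16 / \<beta>) / C_M \<mu> p0 p1 =
          2 * real_of_ereal (A_thr \<mu> p0 p1 \<delta>) * ln (16 / \<beta>) / (C_M \<mu> p0 p1 * \<epsilon>)"
        by (simp add: b_def mult.commute)
      then show "2 * b * ln (16 / \<beta>) / C_M \<mu> p0 p1 \<le>
          max (262 / (C_M \<mu> p0 p1)\<^sup>2 * ln (128 / (3 * \<beta>)))
            (2 * real_of_ereal (A_thr \<mu> p0 p1 \<delta>) * ln (16 / \<beta>) / (C_M \<mu> p0 p1 * \<epsilon>))"
        by simp
    qed (assumption | rule max.cobounded1)+
  qed
qed

end
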